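(* Let $\mathbf{k}$ be a commutative ring and $q\in\mathbf{k}$. Let $\delta$ and $\varepsilon$ be two compositions. Then, in $\mathrm{QSym}$, $$\eta_\delta^{(q)}\eta_\varepsilon^{(q)}=\sum_{f\text{ is a stufufuffler for }\delta\text{ and }\varepsilon}(-q)^{\mathrm{loss}(f)}(q-1)^{\mathrm{poise}(f)}\,\eta^{(q)}_{\mathrm{wt}(f)}.$$
   Context: $\mathbb{N}=\{0,1,2,\ldots\}$; for an integer $m$, $[m]=\{1,2,\ldots,m\}$ (empty if $m\le 0$). A composition is a finite tuple $\alpha=(\alpha_1,\ldots,\alpha_k)$ of positive integers; its length is $\ell(\alpha)=k$, its size is $|\alpha|=\alpha_1+\cdots+\alpha_k$. $\mathrm{Comp}$ is the set of all compositions (including the empty one), and $\mathrm{Comp}_n$ the set of compositions of size $n$. For $\alpha=(\alpha_1,\ldots,\alpha_k)\in\mathrm{Comp}_n$ set $D(\alpha)=\{\alpha_1+\cdots+\alpha_i \mid i\in[k-1]\}\subseteq[n-1]$. $\mathrm{QSym}$ is the $\mathbf{k}$-algebra of quasisymmetric functions over $\mathbf{k}$: the formal power series $f\in\mathbf{k}[[x_1,x_2,x_3,\ldots]]$ of bounded degree such that for all positive integers $a_1,\ldots,a_\ell$ and all $i_1<\cdots<i_\ell$ and $j_1<\cdots<j_\ell$, the coefficients of $x_{i_1}^{a_1}\cdots x_{i_\ell}^{a_\ell}$ and $x_{j_1}^{a_1}\cdots x_{j_\ell}^{a_\ell}$ in $f$ are equal. For a composition $\alpha=(\alpha_1,\ldots,\alpha_\ell)$,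 $M_\alpha=\sum_{i_1<i_2<\cdots<i_\ell}x_{i_1}^{\alpha_1}\cdots x_{i_\ell}^{\alpha_\ell}$; these form a $\mathbf{k}$-basis of $\mathrm{QSym}$. Set $r:=q+1$; for $\alpha\in\mathrm{Comp}_n$, $\eta_\alpha^{(q)}=\sum_{\beta\in\mathrm{Comp}_n;\ D(\beta)\subseteq D(\alpha)}r^{\ell(\beta)}M_\beta\in\mathrm{QSym}$. Stufufufflers. Let $\delta=(\delta_1,\ldots,\delta_\ell)$ and $\varepsilon=(\varepsilon_1,\ldots,\varepsilon_m)$ be compositions. Fix two chains $P=\{p_1<p_2<\cdots<p_\ell\}$ and $Q=\{q_1<q_2<\cdots<q_m\}$, and let $U=P\sqcup Q$ be their disjoint union as posets (each $p_i$ is incomparable to each $q_j$). For a map $f:U\to X$ to a set $X$ and $s\in X$, set $f_P^{-1}(s)=\{u\in[\ell]\mid f(p_u)=s\}$ and $f_Q^{-1}(s)=\{v\in[m]\mid f(q_v)=s\}$. A stufufuffler for $\delta$ and $\varepsilon$ is a surjective and weakly order-preserving map $f:U\to\{1<2<\cdots<k\}$ for some $k\in\mathbb{N}$ (weakly order-preserving: $u<v$ in $U$ implies $f(u)\le f(v)$) such that each $s\in[k]$ satisfies $\bigl||f_P^{-1}(s)|-|f_Q^{-1}(s)|\bigr|\le 1$. For such $f$: - the weight $\mathrm{wt}(f)$ is the composition $(\mathrm{wt}_1(f),\ldots,\mathrm{wt}_k(f))$ with $\mathrm{wt}_s(f)=\sum_{u\in f_P^{-1}(s)}\delta_u+\sum_{v\in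 f_Q^{-1}(s)}\varepsilon_v$; - the loss is the nonnegative integer $\mathrm{loss}(f)=\sum_{s=1}^{k}\max\{|f_P^{-1}(s)|,|f_Q^{-1}(s)|\}-k$; - the poise is $\mathrm{poise}(f)=\#\{s\in[k] : |f_P^{-1}(s)|=|f_Q^{-1}(s)|\}$. *)

theory Defs
  imports Main "HOL-Library.Poly_Mapping" "HOL-Library.FuncSet"
begin

section \<open>Formal power series in countably many variables\<close>

text \<open>
  A monomial is a finitely supported exponent vector of type \<^typ>\<open>nat \<Rightarrow>\<^sub>0 nat\<close>, and a power series
  is an arbitrary family of coefficients indexed by the monomials. The variables \<open>x\<^sub>1, x\<^sub>2, x\<^sub>3, \<dots>\<close>
  are indexed by \<^typ>\<open>nat\<close>: index \<open>i\<close> stands for \<open>x\<^bsub>i+1\<^esub>\<close>.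
\<close>

type_synonym monom = "nat \<Rightarrow>\<^sub>0 nat"

typedef 'a mfps = "UNIV :: (monom \<Rightarrow> 'a) set"
  morphisms coeff Abs_mfps
  by simp

lemma coeff_Abs_mfps [simp]: "coeff (Abs_mfps c) m = c m"
  by (simp add: Abs_mfps_inverse)

lemma mfps_eqI: "(\<And>m. coeff f m = coeff g m) \<Longrightarrow> f = g"
  by (rule coeff_inject[THEN iffD1], rule ext)

definition splittings :: "monom \<Rightarrow> (monom \<times> monom) set" where
  "splittings m = {(u, v). u + v = m}"

lemma finite_splittings [simp, intro]: "finite (splittings m)"
proof -
  let ?K = "Poly_Mapping.keys m" and ?l = "Poly_Mapping.lookup"
  have fin: "finite {u. \<exists>v. u + v = m}"
  proof (rule finite_imageD)
    have "(\<lambda>u. restrict (?l u) ?K) ` {u. \<exists>v. u + v = m} \<subseteq> (\<Pi>\<^sub>E i\<in>?K. {.. ?l m i})"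
      by (auto simp: lookup_add)
    then show "finite ((\<lambda>u. restrict (?l u) ?K) ` {u. \<exists>v. u + v = m})"
      by (rule finite_subset) (intro finite_PiE; simp)
    show "inj_on (\<lambda>u. restrict (?l u) ?K) {u. \<exists>v. u + v = m}"
    proof (rule inj_onI)
      fix u u' assume u: "u \<in> {u. \<exists>v. u + v = m}" and u': "u' \<in> {u. \<exists>v. u + v = m}"
        and eq: "restrict (?l u) ?K = restrict (?l u') ?K"
      show "u = u'"
      proof (rule poly_mapping_eqI)
        fix i
        show "?l u i = ?l u' i"
        proof (cases "i \<in> ?K")
          case True
          then show ?thesis using fun_cong[OF eq, of i] by simp
        next
          case False
          have le: "?l w i \<le> ?l m i" if "\<exists>v. w + v = m" for w
            using that by (auto simp: lookup_add)
          have "?l m i = 0" using False by (simp add: in_keys_iff)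
          then show ?thesis using le[of u] le[of u'] u u' by simp
        qed
      qed
    qed
  qed
  have "(\<lambda>(u, v). u) ` splittings m \<subseteq> {u. \<exists>v. u + v = m}"
    by (auto simp: splittings_def)
  then have "finite ((\<lambda>(u, v). u) ` splittings m)"
    using fin by (rule finite_subset)
  moreover have "inj_on (\<lambda>(u, v). u) (splittings m)"
    by (auto simp: inj_on_def splittings_def)
  ultimately show ?thesis by (rule finite_imageD)
qed

instantiation mfps :: (comm_ring_1) comm_ring_1
begin

definition zero_mfps :: "'a mfps" where
  "0 = Abs_mfps (\<lambda>m. 0)"

definition one_mfps :: "'a mfps" where
  "1 = Abs_mfps (\<lambda>m. if m = 0 then 1 else 0)"

definition plus_mfps :: "'a mfps \<Rightarrow> 'a mfps \<Rightarrow> 'a mfps" where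
  "f + g = Abs_mfps (\<lambda>m. coeff f m + coeff g m)"

definition uminus_mfps :: "'a mfps \<Rightarrow> 'a mfps" where
  "- f = Abs_mfps (\<lambda>m. - coeff f m)"

definition minus_mfps :: "'a mfps \<Rightarrow> 'a mfps \<Rightarrow> 'a mfps" where
  "f - g = Abs_mfps (\<lambda>m. coeff f m - coeff g m)"

definition times_mfps :: "'a mfps \<Rightarrow> 'a mfps \<Rightarrow> 'a mfps" where
  "f * g = Abs_mfps (\<lambda>m. \<Sum>(u, v)\<in>splittings m. coeff f u * coeff g v)"

instance
proof
  fix f g h :: "'a mfps"
  show "f * g * h = f * (g * h)"
  proof (rule mfps_eqI)
    fix m
    have "coeff (f * g * h) m =
        (\<Sum>(x, y)\<in>(SIGMA x:splittings m. splittings (fst x)).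
          coeff f (fst y) * coeff g (snd y) * coeff h (snd x))"
      by (subst sum.Sigma[symmetric]) (auto simp: times_mfps_def sum_distrib_right case_prod_beta)
    also have "\<dots> = (\<Sum>(x, y)\<in>(SIGMA x:splittings m. splittings (snd x)).
          coeff f (fst x) * coeff g (fst y) * coeff h (snd y))"
      by (rule sum.reindex_bij_witness
            [where j = "\<lambda>((u, w), (a, b)). ((a, b + w), (b, w))"
               and i = "\<lambda>((a, w), (b, c)). ((a + b, c), (a, b))"])
         (auto simp: splittings_def add_ac)
    also have "\<dots> = coeff (f * (g * h)) m"
      by (subst sum.Sigma[symmetric])
         (auto simp: times_mfps_def sum_distrib_left case_prod_beta mult.assoc)
    finally show "coeff (f * g * h) m = coeff (f * (g * h)) m" .
  qed
  show "f * g = g * f"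
  proof (rule mfps_eqI)
    fix m
    show "coeff (f * g) m = coeff (g * f) m"
      unfolding times_mfps_def coeff_Abs_mfps
      by (rule sum.reindex_bij_witness[where i = prod.swap and j = prod.swap])
         (auto simp: splittings_def add_ac mult.commute)
  qed
  show "1 * f = f"
  proof (rule mfps_eqI)
    fix m
    have "coeff (1 * f) m = (\<Sum>(u, v)\<in>splittings m. (if u = 0 then 1 else 0) * coeff f v)"
      by (simp add: times_mfps_def one_mfps_def)
    also have "\<dots> = (\<Sum>(u, v)\<in>{(0 :: monom, m)}. (if u = 0 then 1 else 0) * coeff f v)"
    proof (rule sum.mono_neutral_right)
      show "\<forall>p\<in>splittings m - {(0, m)}.
          (case p of (u, v) \<Rightarrow> (if u = 0 then 1 else 0) * coeff f v) = 0"
        by (auto simp: splittings_def split: if_split_asm)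
    qed (auto simp: splittings_def[of m] finite_splittings[unfolded splittings_def])
    finally show "coeff (1 * f) m = coeff f m" by simp
  qed
  show "(f + g) * h = f * h + g * h"
    by (rule mfps_eqI)
       (simp add: times_mfps_def plus_mfps_def distrib_right sum.distrib case_prod_beta)
  show "(0 :: 'a mfps) \<noteq> 1"
  proof
    assume "(0 :: 'a mfps) = 1"
    then have "coeff (0 :: 'a mfps) 0 = coeff 1 0" by (rule arg_cong)
    then show False by (simp add: zero_mfps_def one_mfps_def)
  qed
qed (rule mfps_eqI,
    simp add: plus_mfps_def zero_mfps_def uminus_mfps_def minus_mfps_def add.assoc add.commute)+

end

definition smult :: "'a :: comm_ring_1 \<Rightarrow> 'a mfps \<Rightarrow> 'a mfps"  (infixr \<open>*\<^sub>m\<close> 75) where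
  "c *\<^sub>m f = Abs_mfps (\<lambda>m. c * coeff f m)"

lemma coeff_zero [simp]: "coeff 0 m = 0"
  and coeff_one: "coeff 1 m = (if m = 0 then 1 else 0)"
  and coeff_add [simp]: "coeff (f + g) m = coeff f m + coeff g m"
  and coeff_uminus [simp]: "coeff (- f) m = - coeff f m"
  and coeff_diff [simp]: "coeff (f - g) m = coeff f m - coeff g m"
  and coeff_mult: "coeff (f * g) m = (\<Sum>(u, v)\<in>splittings m. coeff f u * coeff g v)"
  and coeff_smult [simp]: "coeff (c *\<^sub>m f) m = c * coeff f m"
  by (simp_all add: zero_mfps_def one_mfps_def plus_mfps_def uminus_mfps_def minus_mfps_def
      times_mfps_def smult_def)

lemma coeff_sum [simp]: "coeff (\<Sum>i\<in>I. F i) m = (\<Sum>i\<in>I. coeff (F i) m)"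
  by (induction I rule: infinite_finite_induct) auto


section \<open>Quasisymmetric functions\<close>

text \<open>The monomial with exponent list \<open>as\<close> in the variables listed by \<open>is\<close>.\<close>

definition monom_of :: "nat list \<Rightarrow> nat list \<Rightarrow> monom" where
  "monom_of is as = (\<Sum>(i, a)\<leftarrow>zip is as. Poly_Mapping.single i a)"

definition total_degree :: "monom \<Rightarrow> nat" where
  "total_degree m = (\<Sum>i\<in>Poly_Mapping.keys m. Poly_Mapping.lookup m i)"

definition QSym :: "'a :: comm_ring_1 mfps set" where
  "QSym = {f. (\<exists>d. \<forall>m. coeff f m \<noteq> 0 \<longrightarrow> total_degree m \<le> d) \<and>
     (\<forall>as is js. (\<forall>a\<in>set as. 0 < a) \<and> length is = length as \<and> length js = length as \<and>
        sorted_wrt (<) is \<and> sorted_wrt (<) js \<longrightarrow>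
        coeff f (monom_of is as) = coeff f (monom_of js as))}"

definition Comp :: "nat list set" where
  "Comp = {\<alpha>. \<forall>a\<in>set \<alpha>. 0 < a}"

definition Comp_of :: "nat \<Rightarrow> nat list set" where
  "Comp_of n = {\<alpha> \<in> Comp. sum_list \<alpha> = n}"

definition partial_sums :: "nat list \<Rightarrow> nat set" where
  "partial_sums \<alpha> = {sum_list (take i \<alpha>) | i. i \<in> {1..<length \<alpha>}}"

text \<open>
  The coefficient of \<open>m\<close> in \<open>M\<^sub>\<alpha>\<close> counts the summands of the infinite sum
  \<open>\<Sum>\<^bsub>i\<^sub>1 < \<dots> < i\<^sub>\<ell>\<^esub> x\<^bsub>i\<^sub>1\<^esub>\<^bsup>\<alpha>\<^sub>1\<^esup> \<cdots> x\<^bsub>i\<^sub>\<ell>\<^esub>\<^bsup>\<alpha>\<^sub>\<ell>\<^esup>\<close> that are equal to \<open>m\<close>; see \<open>coeff_mono_qsym\<close> below.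
\<close>

definition mono_qsym :: "nat list \<Rightarrow> 'a :: comm_ring_1 mfps" where
  "mono_qsym \<alpha> = Abs_mfps (\<lambda>m. of_nat (card
     {is. length is = length \<alpha> \<and> sorted_wrt (<) is \<and> monom_of is \<alpha> = m}))"

definition eta :: "'a :: comm_ring_1 \<Rightarrow> nat list \<Rightarrow> 'a mfps" where
  "eta q \<alpha> = (\<Sum>\<beta> | \<beta> \<in> Comp_of (sum_list \<alpha>) \<and> partial_sums \<beta> \<subseteq> partial_sums \<alpha>.
     (q + 1) ^ length \<beta> *\<^sub>m mono_qsym \<beta>)"


section \<open>Stufufufflers\<close>

text \<open>
  The poset \<open>U = P \<squnion> Q\<close> is encoded by \<open>p\<^bsub>u+1\<^esub> = Inl u\<close> and \<open>q\<^bsub>v+1\<^esub> = Inr v\<close>, so that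
  \<open>u\<close> and \<open>v\<close> are positions in the lists \<open>\<delta>\<close> and \<open>\<epsilon>\<close>, counted from 0.
\<close>

definition two_chains :: "nat list \<Rightarrow> nat list \<Rightarrow> (nat + nat) set" where
  "two_chains \<delta> \<epsilon> = {..<length \<delta>} <+> {..<length \<epsilon>}"

fun chains_less :: "nat + nat \<Rightarrow> nat + nat \<Rightarrow> bool" where
  "chains_less (Inl u) (Inl u') \<longleftrightarrow> u < u'"
| "chains_less (Inr v) (Inr v') \<longleftrightarrow> v < v'"
| "chains_less _ _ \<longleftrightarrow> False"

definition fibP :: "nat list \<Rightarrow> (nat + nat \<Rightarrow> nat) \<Rightarrow> nat \<Rightarrow> nat set" where
  "fibP \<delta> f s = {u \<in> {..<length \<delta>}. f (Inl u) = s}"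

definition fibQ :: "nat list \<Rightarrow> (nat + nat \<Rightarrow> nat) \<Rightarrow> nat \<Rightarrow> nat set" where
  "fibQ \<epsilon> f s = {v \<in> {..<length \<epsilon>}. f (Inr v) = s}"

text \<open>
  A map from \<open>U\<close> to \<open>{1..k}\<close> is represented together with \<open>k\<close>; it is extensional, so that different
  functions represent different maps.
\<close>

definition stufufufflers :: "nat list \<Rightarrow> nat list \<Rightarrow> (nat \<times> (nat + nat \<Rightarrow> nat)) set" where
  "stufufufflers \<delta> \<epsilon> = {(k, f).
     f \<in> two_chains \<delta> \<epsilon> \<rightarrow>\<^sub>E {1..k} \<and> f ` two_chains \<delta> \<epsilon> = {1..k} \<and>
     (\<forall>x\<in>two_chains \<delta> \<epsilon>. \<forall>y\<in>two_chains \<delta> \<epsilon>. chains_less x y \<longrightarrow> f x \<le> f y) \<and>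
     (\<forall>s\<in>{1..k}. \<bar>int (card (fibP \<delta> f s)) - int (card (fibQ \<epsilon> f s))\<bar> \<le> 1)}"

definition wt_at :: "nat list \<Rightarrow> nat list \<Rightarrow> (nat + nat \<Rightarrow> nat) \<Rightarrow> nat \<Rightarrow> nat" where
  "wt_at \<delta> \<epsilon> f s = (\<Sum>u\<in>fibP \<delta> f s. \<delta> ! u) + (\<Sum>v\<in>fibQ \<epsilon> f s. \<epsilon> ! v)"

definition wt :: "nat list \<Rightarrow> nat list \<Rightarrow> nat \<Rightarrow> (nat + nat \<Rightarrow> nat) \<Rightarrow> nat list" where
  "wt \<delta> \<epsilon> k f = map (wt_at \<delta> \<epsilon> f) [1..<Suc k]"

text \<open>The subtraction does not truncate for stufufufflers: see \<open>loss_no_truncation\<close> below.\<close>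

definition loss :: "nat list \<Rightarrow> nat list \<Rightarrow> nat \<Rightarrow> (nat + nat \<Rightarrow> nat) \<Rightarrow> nat" where
  "loss \<delta> \<epsilon> k f = (\<Sum>s=1..k. max (card (fibP \<delta> f s)) (card (fibQ \<epsilon> f s))) - k"

definition poise :: "nat list \<Rightarrow> nat list \<Rightarrow> nat \<Rightarrow> (nat + nat \<Rightarrow> nat) \<Rightarrow> nat" where
  "poise \<delta> \<epsilon> k f = card {s \<in> {1..k}. card (fibP \<delta> f s) = card (fibQ \<epsilon> f s)}"


section \<open>Well-definedness\<close>

lemma length_le_sum_list: "\<alpha> \<in> Comp \<Longrightarrow> length \<alpha> \<le> sum_list \<alpha>"
  by (induction \<alpha>) (auto simp: Comp_def)

lemma finite_Comp_of [simp, intro]: "finite (Comp_of n)"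
proof (rule finite_subset)
  show "Comp_of n \<subseteq> {\<alpha>. set \<alpha> \<subseteq> {..n} \<and> length \<alpha> \<le> n}"
    using length_le_sum_list by (auto simp: Comp_of_def dest: member_le_sum_list)
  show "finite {\<alpha>. set \<alpha> \<subseteq> {..n} \<and> length \<alpha> \<le> n}"
    by (rule finite_lists_length_le) simp
qed

lemma finite_two_chains [simp, intro]: "finite (two_chains \<delta> \<epsilon>)"
  by (simp add: two_chains_def)

lemma finite_stufufufflers [simp, intro]: "finite (stufufufflers \<delta> \<epsilon>)"
proof (rule finite_subset)
  let ?N = "card (two_chains \<delta> \<epsilon>)"
  have k: "k \<le> ?N" if "f ` two_chains \<delta> \<epsilon> = {1..k}" for k and f :: "nat + nat \<Rightarrow> nat"
    using card_image_le[of "two_chains \<delta> \<epsilon>" f] that by simp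
  show "stufufufflers \<delta> \<epsilon> \<subseteq> (SIGMA k:{..?N}. two_chains \<delta> \<epsilon> \<rightarrow>\<^sub>E {1..k})"
    using k by (auto simp: stufufufflers_def)
  show "finite (SIGMA k:{..?N}. two_chains \<delta> \<epsilon> \<rightarrow>\<^sub>E {1..k})"
    by (intro finite_SigmaI finite_PiE) auto
qed

lemma finite_fib [simp]: "finite (fibP \<delta> f s)" "finite (fibQ \<epsilon> f s)"
  by (simp_all add: fibP_def fibQ_def)

lemma stufufuffler_fib_nonempty:
  assumes "(k, f) \<in> stufufufflers \<delta> \<epsilon>" "s \<in> {1..k}"
  shows "fibP \<delta> f s \<noteq> {} \<or> fibQ \<epsilon> f s \<noteq> {}"
proof -
  have "s \<in> f ` two_chains \<delta> \<epsilon>" using assms by (simp add: stufufufflers_def)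
  then show ?thesis by (auto simp: two_chains_def fibP_def fibQ_def)
qed

lemma loss_no_truncation:
  assumes "(k, f) \<in> stufufufflers \<delta> \<epsilon>"
  shows "k \<le> (\<Sum>s=1..k. max (card (fibP \<delta> f s)) (card (fibQ \<epsilon> f s)))"
proof -
  have "1 \<le> max (card (fibP \<delta> f s)) (card (fibQ \<epsilon> f s))" if "s \<in> {1..k}" for s
    using stufufuffler_fib_nonempty[OF assms that]
    by (auto simp: le_max_iff_disj Suc_le_eq card_gt_0_iff)
  then have "(\<Sum>s=1..k. 1) \<le> (\<Sum>s=1..k. max (card (fibP \<delta> f s)) (card (fibQ \<epsilon> f s)))"
    by (intro sum_mono)
  then show ?thesis by simp
qed

lemma wt_in_Comp:
  assumes "\<delta> \<in> Comp" "\<epsilon> \<in> Comp" "(k, f) \<in> stufufufflers \<delta> \<epsilon>"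
  shows "wt \<delta> \<epsilon> k f \<in> Comp"
proof -
  have "0 < wt_at \<delta> \<epsilon> f s" if "s \<in> {1..k}" for s
  proof -
    have "\<forall>u\<in>fibP \<delta> f s. 0 < \<delta> ! u" "\<forall>v\<in>fibQ \<epsilon> f s. 0 < \<epsilon> ! v"
      using assms by (auto simp: Comp_def fibP_def fibQ_def)
    then show ?thesis
      using stufufuffler_fib_nonempty[OF assms(3) that]
      by (auto simp: wt_at_def intro: sum_pos)
  qed
  then show ?thesis by (auto simp: wt_def Comp_def)
qed

lemma lookup_monom_of:
  assumes "length is = length as"
  shows "Poly_Mapping.lookup (monom_of is as) i = (\<Sum>(j, a)\<leftarrow>zip is as. if j = i then a else 0)"
  using assms
  by (induction "is" as rule: list_induct2)
     (auto simp: monom_of_def lookup_add lookup_single when_def)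

lemma keys_monom_of:
  assumes "length is = length as" "\<forall>a\<in>set as. 0 < a"
  shows "Poly_Mapping.keys (monom_of is as) = set is"
  using assms
proof (induction "is" as rule: list_induct2)
  case Nil
  then show ?case by (simp add: monom_of_def)
next
  case (Cons i "is" a as)
  have "monom_of (i # is) (a # as) = Poly_Mapping.single i a + monom_of is as"
    by (simp add: monom_of_def)
  then show ?case using Cons
    by (auto simp: in_keys_iff lookup_add lookup_single when_def set_eq_iff)
qed

lemma monom_of_inj:
  assumes "length is = length as" "length js = length bs"
    and "\<forall>a\<in>set as. 0 < a" "\<forall>b\<in>set bs. 0 < b"
    and "sorted_wrt (<) is" "sorted_wrt (<) js"
    and "monom_of is as = monom_of js bs"
  shows "is = js \<and> as = bs"
proof
  have "set is = set js"
    using keys_monom_of[OF assms(1,3)] keys_monom_of[OF assms(2,4)] assms(7) by simp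
  then show eq: "is = js"
    using assms(5,6) by (intro strict_sorted_equal)
  have len: "length js = length as" using assms eq by simp
  have "distinct js"
    using assms by (simp add: strict_sorted_iff)
  have uniq: "as = bs" if "length js = length as" "length js = length bs" "distinct js"
    "\<And>i. (\<Sum>(j, a)\<leftarrow>zip js as. if j = i then a else 0) = (\<Sum>(j, a)\<leftarrow>zip js bs. if j = i then a else 0)"
    for js and as bs :: "nat list"
    using that
  proof (induction js as arbitrary: bs rule: list_induct2)
    case (Cons j js a as)
    then obtain b bs' where bs: "bs = b # bs'" by (cases bs) auto
    have nz: "(\<Sum>(j', a)\<leftarrow>zip js cs. if j' = j then a else (0::nat)) = 0" for cs
    proof -
      have "(\<Sum>(j', a)\<leftarrow>zip js cs. if j' = j then a else (0::nat)) = (\<Sum>x\<leftarrow>zip js cs. 0)"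
        using Cons.prems(2) by (intro arg_cong[of _ _ sum_list] map_cong) (auto dest: set_zip_leftD)
      then show ?thesis by simp
    qed
    have "a = b" using Cons.prems(3)[of j] nz by (simp add: bs)
    moreover have "as = bs'"
    proof (rule Cons.IH)
      fix i
      show "(\<Sum>(j, a)\<leftarrow>zip js as. if j = i then a else 0) =
        (\<Sum>(j, a)\<leftarrow>zip js bs'. if j = i then a else 0)"
        using Cons.prems(3)[of i] \<open>a = b\<close> by (simp add: bs)
    qed (use Cons.prems bs in auto)
    ultimately show ?case by (simp add: bs)
  qed simp
  show "as = bs"
  proof (rule uniq)
    show "(\<Sum>(j, a)\<leftarrow>zip js as. if j = i then a else 0) =
      (\<Sum>(j, a)\<leftarrow>zip js bs. if j = i then a else 0)" for i
      using lookup_monom_of[OF assms(1), of i] lookup_monom_of[OF assms(2), of i] assms(7) eq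
      by simp
  qed (use len assms(2) \<open>distinct js\<close> in simp_all)
qed

lemma coeff_mono_qsym:
  assumes "\<alpha> \<in> Comp"
  shows "coeff (mono_qsym \<alpha>) m =
    (if \<exists>is. length is = length \<alpha> \<and> sorted_wrt (<) is \<and> monom_of is \<alpha> = m then 1 else 0)"
proof (cases "\<exists>is. length is = length \<alpha> \<and> sorted_wrt (<) is \<and> monom_of is \<alpha> = m")
  case True
  then obtain "is" where *: "length is = length \<alpha>" "sorted_wrt (<) is" "monom_of is \<alpha> = m" by blast
  have "{is. length is = length \<alpha> \<and> sorted_wrt (<) is \<and> monom_of is \<alpha> = m} = {is}"
    using * assms by (auto simp: Comp_def dest: monom_of_inj)
  then show ?thesis using True by (simp add: mono_qsym_def)
next
  case False
  then have "{is. length is = length \<alpha> \<and> sorted_wrt (<) is \<and> monom_of is \<alpha> = m} = {}" by blast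
  then show ?thesis by (simp add: mono_qsym_def False del: Collect_empty_eq)
qed

lemma total_degree_monom_of:
  assumes "length is = length as" "sorted_wrt (<) is"
  shows "total_degree (monom_of is as) = sum_list as"
  using assms
proof (induction "is" as rule: list_induct2)
  case Nil
  then show ?case by (simp add: monom_of_def total_degree_def)
next
  case (Cons i "is" a as)
  let ?m = "monom_of is as" and ?l = "Poly_Mapping.lookup" and ?K = Poly_Mapping.keys
  have m: "monom_of (i # is) (a # as) = Poly_Mapping.single i a + ?m"
    by (simp add: monom_of_def)
  have k: "?K ?m \<subseteq> set is"
    using Cons.hyps
  proof (induction "is" as rule: list_induct2)
    case (Cons i "is" a as)
    have "monom_of (i # is) (a # as) = Poly_Mapping.single i a + monom_of is as"
      by (simp add: monom_of_def)
    then have "Poly_Mapping.keys (monom_of (i # is) (a # as)) \<subseteq>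
        Poly_Mapping.keys (Poly_Mapping.single i a) \<union> Poly_Mapping.keys (monom_of is as)"
      using keys_add[of "Poly_Mapping.single i a" "monom_of is as"] by metis
    also have "\<dots> \<subseteq> insert i (set is)"
      using Cons.IH by auto
    finally show ?case by simp
  qed (simp add: monom_of_def)
  have z: "?l ?m j = 0" if "j \<notin> set is" for j
    using k that by (metis in_keys_iff subset_iff)
  have i: "i \<notin> set is" using Cons.prems by auto
  have "total_degree (monom_of (i # is) (a # as)) =
      (\<Sum>j\<in>insert i (set is). ?l (Poly_Mapping.single i a + ?m) j)"
    unfolding total_degree_def m using z
    by (intro sum.mono_neutral_left)
       (auto simp: in_keys_iff lookup_add lookup_single when_def split: if_splits)
  also have "\<dots> = ?l (Poly_Mapping.single i a + ?m) i + (\<Sum>j\<in>set is. ?l (Poly_Mapping.single i a + ?m) j)"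
    using i by simp
  also have "?l (Poly_Mapping.single i a + ?m) i = a"
    using i k by (auto simp: lookup_add in_keys_iff)
  also have "(\<Sum>j\<in>set is. ?l (Poly_Mapping.single i a + ?m) j) = (\<Sum>j\<in>set is. ?l ?m j)"
    using i by (intro sum.cong) (auto simp: lookup_add lookup_single when_def)
  also have "\<dots> = total_degree ?m"
    unfolding total_degree_def using k by (intro sum.mono_neutral_right) (auto simp: in_keys_iff)
  finally show ?case using Cons by simp
qed

lemma QSymI:
  fixes f :: "'a :: comm_ring_1 mfps"
  assumes "\<And>m. coeff f m \<noteq> 0 \<Longrightarrow> total_degree m \<le> d"
    and "\<And>(as :: nat list) (is :: nat list) js. \<forall>a\<in>set as. 0 < a \<Longrightarrow> length is = length as \<Longrightarrow> length js = length as \<Longrightarrow>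
      sorted_wrt (<) is \<Longrightarrow> sorted_wrt (<) js \<Longrightarrow>
      coeff f (monom_of is as) = coeff f (monom_of js as)"
  shows "f \<in> QSym"
  unfolding QSym_def mem_Collect_eq
proof (intro conjI exI[of _ d] allI impI)
  show "total_degree m \<le> d" if "coeff f m \<noteq> 0" for m
    using assms(1) that .
next
  fix as "is" js :: "nat list"
  assume *: "(\<forall>a\<in>set as. 0 < a) \<and> length is = length as \<and> length js = length as \<and>
    sorted_wrt (<) is \<and> sorted_wrt (<) js"
  show "coeff f (monom_of is as) = coeff f (monom_of js as)"
    by (rule assms(2)) (use * in simp_all)
qed

lemma QSym_bounded_degree:
  "f \<in> QSym \<Longrightarrow> \<exists>d. \<forall>m. coeff f m \<noteq> 0 \<longrightarrow> total_degree m \<le> d"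
  unfolding QSym_def by simp

lemma QSymD:
  assumes "f \<in> QSym" "\<forall>a\<in>set as. 0 < a" "length is = length as" "length js = length as"
    and "sorted_wrt (<) is" "sorted_wrt (<) js"
  shows "coeff f (monom_of is as) = coeff f (monom_of js as)"
proof -
  have "\<forall>as is js. (\<forall>a\<in>set as. 0 < a) \<and> length is = length as \<and> length js = length as \<and>
      sorted_wrt (<) is \<and> sorted_wrt (<) js \<longrightarrow>
      coeff f (monom_of is as) = coeff f (monom_of js as)"
    using assms(1) unfolding QSym_def mem_Collect_eq by (rule conjunct2)
  from this[rule_format, of as "is" js] show ?thesis using assms(2-) by simp
qed

lemma mono_qsym_in_QSym:
  assumes "\<alpha> \<in> Comp"
  shows "mono_qsym \<alpha> \<in> QSym"
proof -
  have coeff: "coeff (mono_qsym \<alpha> :: 'a mfps) (monom_of is as) = (if as = \<alpha> then 1 else 0)"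
    if *: "\<forall>a\<in>set as. 0 < a" "length is = length as" "sorted_wrt (<) is" for "is" as
  proof (cases "as = \<alpha>")
    case True
    then show ?thesis using * by (auto simp: coeff_mono_qsym[OF assms])
  next
    case False
    have "monom_of js \<alpha> \<noteq> monom_of is as" if "length js = length \<alpha>" "sorted_wrt (<) js" for js
      using monom_of_inj[of js \<alpha> "is" as] * that assms False by (auto simp: Comp_def)
    then show ?thesis using False by (auto simp: coeff_mono_qsym[OF assms])
  qed
  show ?thesis
  proof (rule QSymI)
    fix m assume "coeff (mono_qsym \<alpha> :: 'a mfps) m \<noteq> 0"
    then obtain "is" where "length is = length \<alpha>" "sorted_wrt (<) is" "monom_of is \<alpha> = m"
      by (auto simp: coeff_mono_qsym[OF assms] split: if_splits)
    then show "total_degree m \<le> sum_list \<alpha>"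
      using total_degree_monom_of[of "is" \<alpha>] by simp
  qed (simp add: coeff)
qed

lemma QSym_zero [simp]: "0 \<in> QSym"
  by (rule QSymI) simp_all

lemma QSym_smult:
  assumes "f \<in> QSym"
  shows "c *\<^sub>m f \<in> QSym"
proof -
  obtain d where d: "\<forall>m. coeff f m \<noteq> 0 \<longrightarrow> total_degree m \<le> d"
    using QSym_bounded_degree[OF assms] ..
  show ?thesis
  proof (rule QSymI)
    show "total_degree m \<le> d" if "coeff (c *\<^sub>m f) m \<noteq> 0" for m
      using that by (intro d[rule_format]) auto
  next
    fix as "is" js :: "nat list"
    assume *: "\<forall>a\<in>set as. 0 < a" "length is = length as" "length js = length as"
      "sorted_wrt (<) is" "sorted_wrt (<) js"
    show "coeff (c *\<^sub>m f) (monom_of is as) = coeff (c *\<^sub>m f) (monom_of js as)"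
      using QSymD[OF assms *] by simp
  qed
qed

lemma QSym_add:
  assumes "f \<in> QSym" "g \<in> QSym"
  shows "f + g \<in> QSym"
proof -
  obtain d where d: "\<forall>m. coeff f m \<noteq> 0 \<longrightarrow> total_degree m \<le> d"
    using QSym_bounded_degree[OF assms(1)] ..
  obtain e where e: "\<forall>m. coeff g m \<noteq> 0 \<longrightarrow> total_degree m \<le> e"
    using QSym_bounded_degree[OF assms(2)] ..
  show ?thesis
  proof (rule QSymI)
    fix m assume "coeff (f + g) m \<noteq> 0"
    then have "coeff f m \<noteq> 0 \<or> coeff g m \<noteq> 0" by auto
    then show "total_degree m \<le> max d e" using d[rule_format, of m] e[rule_format, of m] by auto
  next
    fix as "is" js :: "nat list"
    assume *: "\<forall>a\<in>set as. 0 < a" "length is = length as" "length js = length as"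
      "sorted_wrt (<) is" "sorted_wrt (<) js"
    show "coeff (f + g) (monom_of is as) = coeff (f + g) (monom_of js as)"
      using QSymD[OF assms(1) *] QSymD[OF assms(2) *] by simp
  qed
qed

lemma QSym_sum: "(\<And>i. i \<in> I \<Longrightarrow> F i \<in> QSym) \<Longrightarrow> (\<Sum>i\<in>I. F i) \<in> QSym"
  by (induction I rule: infinite_finite_induct) (auto intro: QSym_add)

lemma eta_in_QSym: "eta q \<alpha> \<in> QSym"
  unfolding eta_def by (intro QSym_sum QSym_smult mono_qsym_in_QSym) (auto simp: Comp_of_def)

end

theory Submission
  imports Defs
begin

text \<open>
  Both sides are compared coefficient by coefficient, and the comparison is local in the variables.
  In \<open>\<eta>\<^sub>\<alpha>\<close>, the coefficient of a monomial arises from cutting \<open>\<alpha>\<close> into consecutive, possibly empty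
  blocks, one for each variable, such that the exponent of a variable is the sum of its block;
  every nonempty block contributes a factor \<open>q + 1\<close> (\<open>coeff_eta\<close>). On the left hand side, each
  variable thus receives a block of \<open>\<delta>\<close> and a block of \<open>\<epsilon>\<close>, with a factor \<open>q + 1\<close> for each of the
  two that is nonempty.

  A stufufuffler is determined by the word of its pairs of fibre sizes, which is any word in the
  pairs \<open>(c, d) \<noteq> (0, 0)\<close> with \<open>\<bar>c - d\<bar> \<le> 1\<close> that has the right column sums (\<open>bij_betw_fiber_word\<close>);
  its sign and weight are products over the letters of this word (\<open>word_weight_fiber_word\<close>).
  On the right hand side, a cut of \<open>wt(f)\<close> into blocks is a cut of the word into subwords, and each
  subword again encodes a stufufuffler between a block of \<open>\<delta>\<close> and a block of \<open>\<epsilon>\<close>. Hence it suffices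
  that, for blocks of lengths \<open>l\<close> and \<open>m\<close> that are not both \<open>0\<close>, the total weight of the words with
  column sums \<open>l\<close> and \<open>m\<close>, times \<open>q + 1\<close>, is the factor from the left hand side
  (\<open>sum_word_weight_block_factor\<close>). In other words, this total weight is \<open>1 + q\<close> if \<open>l\<close> and \<open>m\<close> are
  positive, and \<open>1\<close> otherwise.

  In terms of generating functions, the weights of the letters sum to
  \<open>F = (x + y + (q - 1) x y) / (1 + q x y)\<close>, and the total weights of the words are the coefficients
  of \<open>1 / (1 - F) = (1 + q x y) / ((1 - x) (1 - y))\<close>, because
  \<open>1 + q x y - (x + y + (q - 1) x y) = (1 - x) (1 - y)\<close>. This is proved below in the form of
  recurrences (\<open>sum_first_pairs\<close>, \<open>sum_word_weight\<close>).
\<close>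

section \<open>Coefficients of eta\<close>

text \<open>
  A nonempty block is merged into one part of a coarser composition \<open>\<beta>\<close>, and each part of \<open>\<beta>\<close>
  carries a factor \<open>q + 1\<close> in the definition of \<open>\<eta>\<^sub>\<alpha>\<close>.
\<close>

definition block_factor :: "'k :: comm_ring_1 \<Rightarrow> nat \<Rightarrow> 'k" where
  "block_factor q n = (if n = 0 then 1 else q + 1)"

text \<open>
  The sum over all cuts of \<open>\<alpha>\<close> into consecutive blocks with prescribed block sums. Zero exponents
  are allowed: when a monomial of a product is split, a variable may occur in one factor only.
\<close>

fun eta_coeff :: "'k :: comm_ring_1 \<Rightarrow> nat list \<Rightarrow> nat list \<Rightarrow> 'k" where
  "eta_coeff q \<alpha> [] = (if \<alpha> = [] then 1 else 0)"
| "eta_coeff q \<alpha> (a # as) = (\<Sum>i\<le>length \<alpha>.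
     if sum_list (take i \<alpha>) = a then block_factor q i * eta_coeff q (drop i \<alpha>) as else 0)"

text \<open>
  In contrast to \<^const>\<open>partial_sums\<close>, this set also contains \<open>0\<close> and the total sum. It therefore
  behaves well under \<open>#\<close> and \<open>@\<close>, and for compositions of the same size it gives the same
  refinement order.
\<close>

definition prefix_sums :: "nat list \<Rightarrow> nat set" where
  "prefix_sums \<alpha> = (\<lambda>i. sum_list (take i \<alpha>)) ` {..length \<alpha>}"

lemma prefix_sums_Nil [simp]: "prefix_sums [] = {0}"
  by (auto simp: prefix_sums_def)

lemma prefix_sums_Cons: "prefix_sums (a # \<alpha>) = insert 0 ((+) a ` prefix_sums \<alpha>)"
  unfolding prefix_sums_def by (simp add: atMost_Suc_eq_insert_0 image_image del: atMost_Suc)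

lemma prefix_sums_append:
  "prefix_sums (\<alpha> @ \<beta>) = prefix_sums \<alpha> \<union> (+) (sum_list \<alpha>) ` prefix_sums \<beta>"
proof (induction \<alpha>)
  case Nil
  show ?case by (cases \<beta>) (auto simp: prefix_sums_Cons)
qed (auto simp: prefix_sums_Cons image_Un image_image add.assoc)

lemma prefix_sums_le: "x \<in> prefix_sums \<alpha> \<Longrightarrow> x \<le> sum_list \<alpha>"
  by (induction \<alpha> arbitrary: x) (auto simp: prefix_sums_Cons)

lemma prefix_sums_eq:
  assumes "\<alpha> \<in> Comp"
  shows "prefix_sums \<alpha> = {0, sum_list \<alpha>} \<union> partial_sums \<alpha>"
    and "0 \<notin> partial_sums \<alpha>" and "sum_list \<alpha> \<notin> partial_sums \<alpha>"
proof -
  have "{..length \<alpha>} = {0, length \<alpha>} \<union> {1..<length \<alpha>}" by auto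
  then show "prefix_sums \<alpha> = {0, sum_list \<alpha>} \<union> partial_sums \<alpha>"
    by (auto simp: prefix_sums_def partial_sums_def)
  have pos: "sum_list \<beta> > 0" if "\<beta> \<noteq> []" "set \<beta> \<subseteq> set \<alpha>" for \<beta>
    using that assms by (cases \<beta>) (auto simp: Comp_def)
  show "0 \<notin> partial_sums \<alpha>"
  proof
    assume "0 \<in> partial_sums \<alpha>"
    then obtain i where i: "1 \<le> i" "i < length \<alpha>" "sum_list (take i \<alpha>) = 0"
      by (auto simp: partial_sums_def)
    have "take i \<alpha> \<noteq> []" using i by auto
    then show False using i(3) pos[of "take i \<alpha>"] set_take_subset[of i \<alpha>] by linarith
  qed
  show "sum_list \<alpha> \<notin> partial_sums \<alpha>"
  proof
    assume "sum_list \<alpha> \<in> partial_sums \<alpha>"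
    then obtain i where i: "1 \<le> i" "i < length \<alpha>" "sum_list (take i \<alpha>) = sum_list \<alpha>"
      by (auto simp: partial_sums_def)
    have "sum_list \<alpha> = sum_list (take i \<alpha>) + sum_list (drop i \<alpha>)"
      by (metis append_take_drop_id sum_list_append)
    moreover have "drop i \<alpha> \<noteq> []" using i by auto
    ultimately show False using i(3) pos[of "drop i \<alpha>"] set_drop_subset[of i \<alpha>] by linarith
  qed
qed

lemma partial_sums_subset_iff:
  assumes "\<alpha> \<in> Comp" "\<beta> \<in> Comp" "sum_list \<beta> = sum_list \<alpha>"
  shows "partial_sums \<beta> \<subseteq> partial_sums \<alpha> \<longleftrightarrow> prefix_sums \<beta> \<subseteq> prefix_sums \<alpha>"
  using prefix_sums_eq[OF assms(1)] prefix_sums_eq[OF assms(2)] assms(3) by auto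

lemma Comp_take_drop: "\<alpha> \<in> Comp \<Longrightarrow> take i \<alpha> \<in> Comp" "\<alpha> \<in> Comp \<Longrightarrow> drop i \<alpha> \<in> Comp"
  by (auto simp: Comp_def dest: in_set_takeD in_set_dropD)

text \<open>
  The parts of a composition are positive, so at most one initial block has a given sum. Hence a
  cut is determined by its block sums.
\<close>

lemma sum_take_inj:
  assumes "\<alpha> \<in> Comp" "i \<le> length \<alpha>" "j \<le> length \<alpha>"
    "sum_list (take i \<alpha>) = sum_list (take j \<alpha>)"
  shows "i = j"
  using assms
proof (induction \<alpha> arbitrary: i j)
  case (Cons a \<alpha>)
  have "a > 0" "\<alpha> \<in> Comp" using Cons.prems(1) by (auto simp: Comp_def)
  then show ?case using Cons.IH[of "i - 1" "j - 1"] Cons.prems(2-)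
    by (cases i; cases j) simp_all
qed simp

text \<open>
  A composition starting with \<open>b\<close> coarsens \<open>\<alpha>\<close> iff \<open>b\<close> is the sum of an initial block of \<open>\<alpha>\<close> and the
  remaining parts coarsen the rest of \<open>\<alpha>\<close>: the prefix sums of the initial block are too small to
  match any prefix sum that is at least \<open>b\<close>, except for \<open>b\<close> itself.
\<close>

lemma prefix_sums_Cons_subset_iff:
  assumes "i \<le> length \<alpha>" "sum_list (take i \<alpha>) = b" "\<alpha> \<in> Comp"
  shows "prefix_sums (b # \<beta>) \<subseteq> prefix_sums \<alpha> \<longleftrightarrow> prefix_sums \<beta> \<subseteq> prefix_sums (drop i \<alpha>)"
proof -
  have *: "prefix_sums \<alpha> = prefix_sums (take i \<alpha>) \<union> (+) b ` prefix_sums (drop i \<alpha>)"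
    using prefix_sums_append[of "take i \<alpha>" "drop i \<alpha>"] assms by simp
  have 0: "0 \<in> prefix_sums \<gamma>" for \<gamma> by (cases \<gamma>) (auto simp: prefix_sums_Cons)
  have "x \<in> prefix_sums (drop i \<alpha>)" if "b + x \<in> prefix_sums (take i \<alpha>)" for x
    using prefix_sums_le[OF that] assms 0 by simp
  then show ?thesis using 0 unfolding prefix_sums_Cons by (auto simp: *)
qed

text \<open>
  At most one cut has the given block sums. It exists iff the nonzero block sums form a composition
  that is coarser than \<open>\<alpha>\<close>, and its nonempty blocks are the ones with nonzero sums.
\<close>

lemma eta_coeff_eq:
  assumes "\<alpha> \<in> Comp"
  defines "coarsens \<equiv> \<lambda>\<beta> \<alpha>. sum_list \<beta> = sum_list \<alpha> \<and> prefix_sums \<beta> \<subseteq> prefix_sums \<alpha>"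
  shows "eta_coeff q \<alpha> as =
    (let \<beta> = filter (\<lambda>a. 0 < a) as in if coarsens \<beta> \<alpha> then (q + 1) ^ length \<beta> else 0)"
  using assms(1)
proof (induction as arbitrary: \<alpha>)
  case Nil
  have "0 \<in> prefix_sums \<alpha>" by (cases \<alpha>) (auto simp: prefix_sums_Cons)
  then show ?case using Nil by (cases \<alpha>) (auto simp: coarsens_def Comp_def)
next
  case (Cons a as)
  define \<beta> where "\<beta> = filter (\<lambda>a. 0 < a) as"
  let ?t = "\<lambda>i. if sum_list (take i \<alpha>) = a then block_factor q i * eta_coeff q (drop i \<alpha>) as else 0"
  show ?case
  proof (cases "\<exists>i\<le>length \<alpha>. sum_list (take i \<alpha>) = a")
    case True
    then obtain i where i: "i \<le> length \<alpha>" "sum_list (take i \<alpha>) = a" by blast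
    have i0: "i = 0 \<longleftrightarrow> a = 0"
      using sum_take_inj[OF Cons.prems i(1), of 0] i(2) by auto
    have "eta_coeff q \<alpha> (a # as) = (\<Sum>j\<le>length \<alpha>. if j = i then ?t i else 0)"
      unfolding eta_coeff.simps
    proof (rule sum.cong)
      fix j assume "j \<in> {..length \<alpha>}"
      then have "sum_list (take j \<alpha>) = a \<longleftrightarrow> j = i"
        using sum_take_inj[OF Cons.prems i(1), of j] i by (metis atMost_iff)
      then show "?t j = (if j = i then ?t i else 0)" using i(2) by auto
    qed simp
    also have "\<dots> = block_factor q i * eta_coeff q (drop i \<alpha>) as"
      using i by simp
    also have "\<dots> = block_factor q i * (if coarsens \<beta> (drop i \<alpha>) then (q + 1) ^ length \<beta> else 0)"
      using Cons.IH[OF Comp_take_drop(2)[OF Cons.prems]] by (simp add: \<beta>_def)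
    finally have eq: "eta_coeff q \<alpha> (a # as) =
      block_factor q i * (if coarsens \<beta> (drop i \<alpha>) then (q + 1) ^ length \<beta> else 0)" .
    have "sum_list \<alpha> = a + sum_list (drop i \<alpha>)"
      using i by (metis append_take_drop_id sum_list_append)
    then have "coarsens (a # \<beta>) \<alpha> \<longleftrightarrow> coarsens \<beta> (drop i \<alpha>)"
      unfolding coarsens_def using prefix_sums_Cons_subset_iff[OF i Cons.prems] by auto
    then show ?thesis unfolding eq using i0
      by (auto simp: Let_def \<beta>_def[symmetric] block_factor_def)
  next
    case False
    have "0 \<in> prefix_sums \<beta>" by (cases \<beta>) (auto simp: prefix_sums_Cons)
    then have "a \<in> prefix_sums (a # \<beta>)"
      by (force simp: prefix_sums_Cons)
    moreover have "a \<notin> prefix_sums \<alpha>"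
      using False by (auto simp: prefix_sums_def)
    ultimately have "\<not> coarsens (a # \<beta>) \<alpha>"
      by (auto simp: coarsens_def)
    moreover have "a \<noteq> 0" using False by force
    moreover have "eta_coeff q \<alpha> (a # as) = 0"
      unfolding eta_coeff.simps by (rule sum.neutral) (use False in auto)
    ultimately show ?thesis by (simp add: \<beta>_def)
  qed
qed

lemma monom_of_Cons: "monom_of (i # is) (a # as) = Poly_Mapping.single i a + monom_of is as"
  by (simp add: monom_of_def)

lemma monom_of_drop_zeros:
  assumes "length is = length as" "sorted_wrt (<) is"
  shows "\<exists>js. length js = length (filter (\<lambda>a. 0 < a) as) \<and> sorted_wrt (<) js \<and> set js \<subseteq> set is \<and>
    monom_of js (filter (\<lambda>a. 0 < a) as) = monom_of is as"
  using assms
proof (induction "is" as rule: list_induct2)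
  case (Cons i "is" a as)
  then obtain js where js: "length js = length (filter (\<lambda>a. 0 < a) as)" "sorted_wrt (<) js"
    "set js \<subseteq> set is" "monom_of js (filter (\<lambda>a. 0 < a) as) = monom_of is as" by auto
  show ?case
  proof (cases "a = 0")
    case True
    then show ?thesis using js by (intro exI[of _ js]) (auto simp: monom_of_Cons)
  next
    case False
    then show ?thesis using js Cons.prems
      by (intro exI[of _ "i # js"]) (auto simp: monom_of_Cons)
  qed
qed simp

text \<open>
  The quasisymmetric functions \<open>M\<^sub>\<beta>\<close> have disjoint supports: the only one that contains the given
  monomial belongs to the composition of its nonzero exponents.
\<close>

lemma coeff_eta:
  fixes q :: "'k :: comm_ring_1"
  assumes \<alpha>: "\<alpha> \<in> Comp" and len: "length is = length as" and sorted: "sorted_wrt (<) is"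
  shows "coeff (eta q \<alpha>) (monom_of is as) = eta_coeff q \<alpha> as"
proof -
  define \<gamma> where "\<gamma> = filter (\<lambda>a. 0 < a) as"
  define C where "C = {\<beta>. \<beta> \<in> Comp_of (sum_list \<alpha>) \<and> partial_sums \<beta> \<subseteq> partial_sums \<alpha>}"
  have fin: "finite C"
    by (rule finite_subset[OF _ finite_Comp_of[of "sum_list \<alpha>"]]) (auto simp: C_def)
  have \<gamma>: "\<gamma> \<in> Comp" by (auto simp: \<gamma>_def Comp_def)
  obtain js where js: "length js = length \<gamma>" "sorted_wrt (<) js" "monom_of js \<gamma> = monom_of is as"
    using monom_of_drop_zeros[OF len sorted] unfolding \<gamma>_def by blast
  have M: "coeff (mono_qsym \<beta> :: 'k mfps) (monom_of is as) = (if \<beta> = \<gamma> then 1 else 0)" if "\<beta> \<in> C" for \<beta>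
  proof -
    have \<beta>: "\<beta> \<in> Comp" using that by (auto simp: C_def Comp_of_def)
    have uniq: "\<beta> = \<gamma>" if "length ks = length \<beta>" "sorted_wrt (<) ks" "monom_of ks \<beta> = monom_of is as" for ks
      using monom_of_inj[of ks \<beta> js \<gamma>] that js \<beta> \<gamma> by (auto simp: Comp_def)
    show ?thesis
    proof (cases "\<beta> = \<gamma>")
      case True
      then show ?thesis unfolding coeff_mono_qsym[OF \<beta>] using js by metis
    next
      case False
      then show ?thesis unfolding coeff_mono_qsym[OF \<beta>] using uniq by metis
    qed
  qed
  have "coeff (eta q \<alpha>) (monom_of is as) = (\<Sum>\<beta>\<in>C. if \<beta> = \<gamma> then (q + 1) ^ length \<gamma> else 0)"
    unfolding eta_def C_def[symmetric] by (auto simp: M intro!: sum.cong)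
  also have "\<dots> = (if \<gamma> \<in> C then (q + 1) ^ length \<gamma> else 0)"
    using fin by simp
  also have "\<gamma> \<in> C \<longleftrightarrow> sum_list \<gamma> = sum_list \<alpha> \<and> prefix_sums \<gamma> \<subseteq> prefix_sums \<alpha>"
    using partial_sums_subset_iff[OF \<alpha> \<gamma>] \<gamma> by (auto simp: C_def Comp_of_def)
  finally show ?thesis
    unfolding eta_coeff_eq[OF \<alpha>] Let_def \<gamma>_def[symmetric] .
qed

section \<open>Coefficients of a product\<close>

lemma lookup_monom_of_notin:
  assumes "length is = length as" "i \<notin> set is"
  shows "Poly_Mapping.lookup (monom_of is as) i = 0"
  using assms
  by (induction "is" as rule: list_induct2)
     (auto simp: monom_of_Cons lookup_add lookup_single monom_of_def[of "[]"])

lemma map_lookup_monom_of: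
  assumes "length is = length as" "distinct is"
  shows "map (Poly_Mapping.lookup (monom_of is as)) is = as"
  using assms
proof (induction "is" as rule: list_induct2)
  case (Cons j "is" a as)
  have "map (Poly_Mapping.lookup (monom_of (j # is) (a # as))) is =
      map (Poly_Mapping.lookup (monom_of is as)) is"
    using Cons.prems by (auto simp: monom_of_Cons lookup_add lookup_single when_def)
  moreover have "Poly_Mapping.lookup (monom_of (j # is) (a # as)) j = a"
    using Cons.hyps Cons.prems by (simp add: monom_of_Cons lookup_add lookup_monom_of_notin)
  ultimately show ?case using Cons by (simp del: map_eq_conv)
qed simp

lemma monom_of_map_lookup:
  assumes "distinct is" "Poly_Mapping.keys u \<subseteq> set is"
  shows "monom_of is (map (Poly_Mapping.lookup u) is) = u"
proof (rule poly_mapping_eqI)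
  fix i
  show "Poly_Mapping.lookup (monom_of is (map (Poly_Mapping.lookup u) is)) i = Poly_Mapping.lookup u i"
  proof (cases "i \<in> set is")
    case True
    then show ?thesis
      using map_lookup_monom_of[of "is" "map (Poly_Mapping.lookup u) is"] assms by simp
  next
    case False
    then show ?thesis
      using lookup_monom_of_notin[of "is" "map (Poly_Mapping.lookup u) is" i] assms
      by (auto simp: in_keys_iff)
  qed
qed

definition lists_below :: "nat list \<Rightarrow> nat list set" where
  "lists_below cs = {as. list_all2 (\<le>) as cs}"

lemma lists_below_Nil [simp]: "lists_below [] = {[]}"
  by (auto simp: lists_below_def)

lemma sum_lists_below_Cons:
  "(\<Sum>as\<in>lists_below (c # cs). F as) = (\<Sum>a\<le>c. \<Sum>as\<in>lists_below cs. F (a # as))"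
proof -
  have "lists_below (c # cs) = (\<lambda>(a, as). a # as) ` ({..c} \<times> lists_below cs)"
    by (auto simp: lists_below_def list_all2_Cons2 image_iff)
  moreover have "inj_on (\<lambda>(a, as). a # as) ({..c} \<times> lists_below cs)"
    by (auto simp: inj_on_def)
  ultimately show ?thesis
    by (simp add: sum.reindex sum.cartesian_product comp_def split_def)
qed

lemma monom_of_add:
  assumes "list_all2 (\<le>) as cs" "length is = length cs"
  shows "monom_of is as + monom_of is (map2 (-) cs as) = monom_of is cs"
  using assms
proof (induction as cs arbitrary: "is" rule: list_all2_induct)
  case (Cons a as c cs)
  then obtain i js where "is": "is = i # js" by (cases "is") auto
  have "Poly_Mapping.single i a + Poly_Mapping.single i (c - a) = Poly_Mapping.single i c"
    using Cons.hyps by (simp flip: single_add)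
  then show ?case using Cons.IH[of js] Cons.prems
    by (simp add: "is" monom_of_Cons) (metis (no_types, lifting) add.assoc add.left_commute)
qed (simp add: monom_of_def)

text \<open>
  Both factors of a monomial only involve the variables of the monomial, so the splittings can be
  described by exponent lists over the same list of variables.
\<close>

lemma coeff_mult_monom_of:
  assumes "length is = length cs" "distinct is"
  shows "coeff (f * g) (monom_of is cs) =
    (\<Sum>as\<in>lists_below cs. coeff f (monom_of is as) * coeff g (monom_of is (map2 (-) cs as)))"
proof -
  have "(\<Sum>(u, v)\<in>splittings (monom_of is cs). coeff f u * coeff g v) =
    (\<Sum>as\<in>lists_below cs. coeff f (monom_of is as) * coeff g (monom_of is (map2 (-) cs as)))"
  proof (rule sum.reindex_bij_witness[where
        i = "\<lambda>as. (monom_of is as, monom_of is (map2 (-) cs as))" and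
        j = "\<lambda>(u, v). map (Poly_Mapping.lookup u) is"])
    fix p assume "p \<in> splittings (monom_of is cs)"
    then obtain u v where p: "p = (u, v)" and uv: "u + v = monom_of is cs"
      by (auto simp: splittings_def)
    have l: "Poly_Mapping.lookup u i + Poly_Mapping.lookup v i =
        Poly_Mapping.lookup (monom_of is cs) i" for i
      using uv by (metis lookup_add)
    have "Poly_Mapping.lookup u i = 0 \<and> Poly_Mapping.lookup v i = 0" if "i \<notin> set is" for i
      using lookup_monom_of_notin[OF assms(1) that] l[of i] by simp
    then have keys: "Poly_Mapping.keys u \<subseteq> set is" "Poly_Mapping.keys v \<subseteq> set is"
      by (metis in_keys_iff subsetI)+
    have cs: "cs = map (\<lambda>i. Poly_Mapping.lookup u i + Poly_Mapping.lookup v i) is"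
      using map_lookup_monom_of[OF assms] by (simp add: l)
    have v: "map2 (-) cs (map (Poly_Mapping.lookup u) is) = map (Poly_Mapping.lookup v) is"
      unfolding cs by (simp add: map2_map_map)
    have m: "monom_of is (map (Poly_Mapping.lookup u) is) = u"
      "monom_of is (map (Poly_Mapping.lookup v) is) = v"
      using monom_of_map_lookup[OF assms(2)] keys by auto
    show "(case p of (u, v) \<Rightarrow> map (Poly_Mapping.lookup u) is) \<in> lists_below cs"
      unfolding p lists_below_def cs by (auto simp: list_all2_conv_all_nth)
    show "(monom_of is (case p of (u, v) \<Rightarrow> map (Poly_Mapping.lookup u) is),
      monom_of is (map2 (-) cs (case p of (u, v) \<Rightarrow> map (Poly_Mapping.lookup u) is))) = p"
      by (simp add: p v m)
    show "coeff f (monom_of is (case p of (u, v) \<Rightarrow> map (Poly_Mapping.lookup u) is)) *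
      coeff g (monom_of is (map2 (-) cs (case p of (u, v) \<Rightarrow> map (Poly_Mapping.lookup u) is))) =
      (case p of (u, v) \<Rightarrow> coeff f u * coeff g v)"
      by (simp add: p v m)
  next
    fix as assume "as \<in> lists_below cs"
    then have le: "list_all2 (\<le>) as cs" by (simp add: lists_below_def)
    then have "length is = length as" using assms by (auto dest: list_all2_lengthD)
    then show "(case (monom_of is as, monom_of is (map2 (-) cs as)) of
        (u, v) \<Rightarrow> map (Poly_Mapping.lookup u) is) = as"
      using map_lookup_monom_of assms by simp
    show "(monom_of is as, monom_of is (map2 (-) cs as)) \<in> splittings (monom_of is cs)"
      using monom_of_add[OF le] assms by (simp add: splittings_def)
  qed
  then show ?thesis by (simp add: coeff_mult)
qed

section \<open>Words of fibre sizes\<close>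

text \<open>
  The possible pairs of sizes of the two parts of a fibre of a stufufuffler.
\<close>

definition fiber_pairs :: "(nat \<times> nat) set" where
  "fiber_pairs = {(c, d). (c, d) \<noteq> (0, 0) \<and> c \<le> d + 1 \<and> d \<le> c + 1}"

definition fiber_words :: "nat \<Rightarrow> nat \<Rightarrow> (nat \<times> nat) list set" where
  "fiber_words l m =
    {w. set w \<subseteq> fiber_pairs \<and> sum_list (map fst w) = l \<and> sum_list (map snd w) = m}"

definition pair_weight :: "'k :: comm_ring_1 \<Rightarrow> nat \<times> nat \<Rightarrow> 'k" where
  "pair_weight q p = (- q) ^ (max (fst p) (snd p) - 1) * (if fst p = snd p then q - 1 else 1)"

definition word_weight :: "'k :: comm_ring_1 \<Rightarrow> (nat \<times> nat) list \<Rightarrow> 'k" where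
  "word_weight q w = prod_list (map (pair_weight q) w)"

lemma word_weight_simps [simp]:
  "word_weight q [] = 1"
  "word_weight q (p # w) = pair_weight q p * word_weight q w"
  "word_weight q (u @ v) = word_weight q u * word_weight q v"
  by (simp_all add: word_weight_def)

lemma length_fiber_word: "set w \<subseteq> fiber_pairs \<Longrightarrow> length w \<le> sum_list (map fst w) + sum_list (map snd w)"
  by (induction w) (auto simp: fiber_pairs_def)

lemma finite_fiber_words [simp, intro]: "finite (fiber_words l m)"
proof (rule finite_subset)
  show "fiber_words l m \<subseteq> {w. set w \<subseteq> {..l} \<times> {..m} \<and> length w \<le> l + m}"
    using length_fiber_word by (force simp: fiber_words_def intro: member_le_sum_list)
  show "finite {w. set w \<subseteq> {..l} \<times> {..m} \<and> length w \<le> l + m}"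
    by (rule finite_lists_length_le) simp
qed

lemma Nil_in_fiber_words_iff: "[] \<in> fiber_words l m \<longleftrightarrow> l = 0 \<and> m = 0"
  by (auto simp: fiber_words_def)

lemma fiber_words_0_0: "fiber_words 0 0 = {[]}"
proof -
  have "w = []" if "w \<in> fiber_words 0 0" for w
    using length_fiber_word[of w] that by (simp add: fiber_words_def del: sum_list_eq_0_iff)
  then show ?thesis by (auto simp: Nil_in_fiber_words_iff)
qed

definition first_pairs :: "nat \<Rightarrow> nat \<Rightarrow> (nat \<times> nat) set" where
  "first_pairs l m = {p \<in> fiber_pairs. fst p \<le> l \<and> snd p \<le> m}"

lemma finite_first_pairs [simp, intro]: "finite (first_pairs l m)"
  by (rule finite_subset[of _ "{..l} \<times> {..m}"]) (auto simp: first_pairs_def)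

lemma sum_fiber_words_hd:
  assumes "(l, m) \<noteq> (0, 0)"
  shows "(\<Sum>w\<in>fiber_words l m. F w) =
    (\<Sum>p\<in>first_pairs l m. \<Sum>w\<in>fiber_words (l - fst p) (m - snd p). F (p # w))"
proof -
  have "(\<Sum>w\<in>fiber_words l m. F w) =
    (\<Sum>(p, w)\<in>(SIGMA p:first_pairs l m. fiber_words (l - fst p) (m - snd p)). F (p # w))"
  proof (rule sum.reindex_bij_witness[where i = "\<lambda>(p, w). p # w" and j = "\<lambda>w. (hd w, tl w)"])
    fix w assume w: "w \<in> fiber_words l m"
    then have "w \<noteq> []" using assms Nil_in_fiber_words_iff by auto
    then obtain p v where "w = p # v" by (cases w) auto
    then show "(case (hd w, tl w) of (p, w) \<Rightarrow> p # w) = w"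
      "(hd w, tl w) \<in> (SIGMA p:first_pairs l m. fiber_words (l - fst p) (m - snd p))"
      "(case (hd w, tl w) of (p, w) \<Rightarrow> F (p # w)) = F w"
      using w by (auto simp: fiber_words_def first_pairs_def)
  qed (auto simp: fiber_words_def first_pairs_def)
  then show ?thesis by (simp add: sum.Sigma)
qed

text \<open>
  The coefficients of \<open>(1 + q x y) / ((1 - x) (1 - y))\<close>.
\<close>

definition word_total :: "'k :: comm_ring_1 \<Rightarrow> nat \<Rightarrow> nat \<Rightarrow> 'k" where
  "word_total q l m = (if l = 0 \<or> m = 0 then 1 else 1 + q)"

text \<open>
  Multiplication of a letter by \<open>x y\<close> multiplies its weight by \<open>- q\<close>; this is where the
  denominator \<open>1 + q x y\<close> of the generating function of the letters comes from.
\<close>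

lemma pair_weight_Suc:
  assumes "p \<in> fiber_pairs"
  shows "pair_weight q (Suc (fst p), Suc (snd p)) = - q * pair_weight q p"
proof -
  have "max (fst p) (snd p) \<noteq> 0"
    using assms by (cases p) (auto simp: fiber_pairs_def)
  then obtain k where k: "max (fst p) (snd p) = Suc k" using not0_implies_Suc by blast
  then have "max (Suc (fst p)) (Suc (snd p)) = Suc (Suc k)" by simp
  with k show ?thesis unfolding pair_weight_def fst_conv snd_conv by (simp add: mult.assoc)
qed

text \<open>
  The recurrence expressing that \<^const>\<open>word_total\<close> is the coefficient sequence of \<open>1 / (1 - F)\<close> for
  the generating function \<open>F\<close> of the letters. The sum on the left is computed by descending along
  the diagonal: every letter with two positive entries is \<open>(1, 1)\<close> or arises from another letter by
  raising both entries, so the sum for \<open>(l + 1, m + 1)\<close> is \<open>- q\<close> times the sum for \<open>(l, m)\<close> plus the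
  contributions of \<open>(1, 0)\<close>, \<open>(0, 1)\<close> and \<open>(1, 1)\<close>.
\<close>

lemma sum_first_pairs:
  assumes "(l, m) \<noteq> (0, 0)"
  shows "(\<Sum>p\<in>first_pairs l m. pair_weight q p * word_total q (l - fst p) (m - snd p)) =
    word_total q l m"
  using assms
proof (induction l arbitrary: m)
  case 0
  then have "first_pairs 0 m = {(0, 1)}" by (auto simp: first_pairs_def fiber_pairs_def)
  then show ?case by (simp add: pair_weight_def word_total_def)
next
  case (Suc l)
  show ?case
  proof (cases m)
    case 0
    then have "first_pairs (Suc l) m = {(1, 0)}" by (auto simp: first_pairs_def fiber_pairs_def)
    then show ?thesis using 0 by (simp add: pair_weight_def word_total_def)
  next
    case (Suc n)
    define shift :: "nat \<times> nat \<Rightarrow> nat \<times> nat" where "shift = (\<lambda>p. (Suc (fst p), Suc (snd p)))"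
    let ?S = "\<lambda>l m. \<Sum>p\<in>first_pairs l m. pair_weight q p * word_total q (l - fst p) (m - snd p)"
    have split: "first_pairs (Suc l) m = {(1, 0), (0, 1), (1, 1)} \<union> shift ` first_pairs l n"
    proof (intro set_eqI iffI)
      fix p assume p: "p \<in> first_pairs (Suc l) m"
      show "p \<in> {(1, 0), (0, 1), (1, 1)} \<union> shift ` first_pairs l n"
      proof (cases "p \<in> {(1, 0), (0, 1), (1, 1)}")
        case False
        then have "p = shift (fst p - 1, snd p - 1)" "(fst p - 1, snd p - 1) \<in> first_pairs l n"
          using p by (cases p; auto simp: first_pairs_def fiber_pairs_def shift_def Suc)+
        then show ?thesis by blast
      qed auto
    qed (auto simp: first_pairs_def fiber_pairs_def shift_def Suc)
    have disj: "{(1, 0), (0, 1), (1, 1)} \<inter> shift ` first_pairs l n = {}"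
      by (auto simp: first_pairs_def fiber_pairs_def shift_def)
    have "(\<Sum>p\<in>shift ` first_pairs l n. pair_weight q p * word_total q (Suc l - fst p) (m - snd p)) =
        (\<Sum>p\<in>first_pairs l n. - q * (pair_weight q p * word_total q (l - fst p) (n - snd p)))"
    proof (subst sum.reindex)
      show "inj_on shift (first_pairs l n)" by (auto simp: inj_on_def shift_def prod_eq_iff)
    qed (auto simp: first_pairs_def shift_def Suc pair_weight_Suc[simplified] intro!: sum.cong)
    then have rec: "?S (Suc l) m = word_total q l m + word_total q (Suc l) n +
        (q - 1) * word_total q l n - q * ?S l n"
      unfolding split
      by (subst sum.union_disjoint[OF _ _ disj])
         (simp_all add: pair_weight_def Suc sum_negf flip: sum_distrib_left)
    show ?thesis
    proof (cases "(l, n) = (0, 0)")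
      case True
      have "first_pairs 0 0 = {}" by (auto simp: first_pairs_def fiber_pairs_def)
      then show ?thesis unfolding rec using True Suc by (simp add: word_total_def)
    next
      case False
      then show ?thesis unfolding rec Suc.IH[OF False] using Suc
        by (auto simp: word_total_def algebra_simps)
    qed
  qed
qed

lemma sum_word_weight: "(\<Sum>w\<in>fiber_words l m. word_weight q w) = word_total q l m"
proof (induction "l + m" arbitrary: l m rule: less_induct)
  case less
  show ?case
  proof (cases "(l, m) = (0, 0)")
    case True
    then show ?thesis by (simp add: fiber_words_0_0 word_total_def)
  next
    case False
    have "(\<Sum>w\<in>fiber_words l m. word_weight q w) =
      (\<Sum>p\<in>first_pairs l m. pair_weight q p * (\<Sum>w\<in>fiber_words (l - fst p) (m - snd p). word_weight q w))"
      by (simp add: sum_fiber_words_hd[OF False] sum_distrib_left)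
    also have "\<dots> = (\<Sum>p\<in>first_pairs l m. pair_weight q p * word_total q (l - fst p) (m - snd p))"
    proof (rule sum.cong)
      fix p assume "p \<in> first_pairs l m"
      then have "l - fst p + (m - snd p) < l + m"
        by (cases p) (auto simp: first_pairs_def fiber_pairs_def)
      then show "pair_weight q p * (\<Sum>w\<in>fiber_words (l - fst p) (m - snd p). word_weight q w) =
        pair_weight q p * word_total q (l - fst p) (m - snd p)"
        using less by simp
    qed simp
    also have "\<dots> = word_total q l m" by (rule sum_first_pairs[OF False])
    finally show ?thesis .
  qed
qed

text \<open>
  The identity for a single variable: all stufufufflers between a block of length \<open>l\<close> and a block
  of length \<open>m\<close> together, viewed as one block of the weight composition, contribute as much as the
  two blocks themselves.
\<close>

lemma sum_word_weight_block_factor: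
  "(\<Sum>w\<in>fiber_words l m. word_weight q w * block_factor q (length w)) =
    block_factor q l * block_factor q m"
proof (cases "(l, m) = (0, 0)")
  case True
  then show ?thesis by (simp add: fiber_words_0_0 block_factor_def)
next
  case False
  have "(\<Sum>w\<in>fiber_words l m. word_weight q w * block_factor q (length w)) =
    (\<Sum>w\<in>fiber_words l m. word_weight q w * (q + 1))"
    using False Nil_in_fiber_words_iff[of l m]
    by (intro sum.cong) (auto simp: block_factor_def)
  also have "\<dots> = word_total q l m * (q + 1)"
    by (simp add: sum_word_weight flip: sum_distrib_right)
  also have "\<dots> = block_factor q l * block_factor q m"
    using False by (auto simp: word_total_def block_factor_def add.commute)
  finally show ?thesis .
qed

text \<open>
  A word together with a place to cut it is the same as two words whose column sums add up.
\<close>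

lemma sum_fiber_words_split:
  "(\<Sum>w\<in>fiber_words l m. \<Sum>t\<le>length w. G (take t w) (drop t w)) =
    (\<Sum>i\<le>l. \<Sum>j\<le>m. \<Sum>u\<in>fiber_words i j. \<Sum>v\<in>fiber_words (l - i) (m - j). G u v)"
proof -
  let ?f = "\<lambda>w. sum_list (map fst w)" and ?s = "\<lambda>w. sum_list (map snd w)"
  have td: "?f w = ?f (take t w) + ?f (drop t w)" "?s w = ?s (take t w) + ?s (drop t w)"
    for w :: "(nat \<times> nat) list" and t
    by (metis append_take_drop_id map_append sum_list_append)+
  have "(\<Sum>w\<in>fiber_words l m. \<Sum>t\<le>length w. G (take t w) (drop t w)) =
    (\<Sum>(w, t)\<in>(SIGMA w:fiber_words l m. {..length w}). G (take t w) (drop t w))"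
    by (simp add: sum.Sigma)
  also have "\<dots> = (\<Sum>((i, j), (u, v))\<in>(SIGMA p:{..l} \<times> {..m}.
      fiber_words (fst p) (snd p) \<times> fiber_words (l - fst p) (m - snd p)). G u v)"
  proof (rule sum.reindex_bij_witness[where
        j = "\<lambda>(w, t). ((?f (take t w), ?s (take t w)), (take t w, drop t w))" and
        i = "\<lambda>((i, j), (u, v)). (u @ v, length u)"])
    fix x assume "x \<in> (SIGMA w:fiber_words l m. {..length w})"
    then obtain w t where x: "x = (w, t)" and w: "w \<in> fiber_words l m" "t \<le> length w" by auto
    show "(case x of (w, t) \<Rightarrow> ((?f (take t w), ?s (take t w)), (take t w, drop t w)))
      \<in> (SIGMA p:{..l} \<times> {..m}.
      fiber_words (fst p) (snd p) \<times> fiber_words (l - fst p) (m - snd p))"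
      using w(1) td[of w t] set_take_subset[of t w] set_drop_subset[of t w]
      unfolding x by (auto simp: fiber_words_def)
  qed (auto simp: fiber_words_def)
  also have "\<dots> = (\<Sum>p\<in>{..l} \<times> {..m}. \<Sum>x\<in>fiber_words (fst p) (snd p) \<times>
      fiber_words (l - fst p) (m - snd p). G (fst x) (snd x))"
    by (subst sum.Sigma) (auto simp: case_prod_beta)
  also have "\<dots> = (\<Sum>i\<le>l. \<Sum>j\<le>m. \<Sum>u\<in>fiber_words i j. \<Sum>v\<in>fiber_words (l - i) (m - j). G u v)"
    by (simp add: sum.cartesian_product case_prod_beta)
  finally show ?thesis .
qed

text \<open>
  The weight composition of the stufufuffler encoded by a word, read off letter by letter.
\<close>

fun word_wt :: "(nat \<times> nat) list \<Rightarrow> nat list \<Rightarrow> nat list \<Rightarrow> nat list" where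
  "word_wt [] \<delta> \<epsilon> = []"
| "word_wt (p # w) \<delta> \<epsilon> = (sum_list (take (fst p) \<delta>) + sum_list (take (snd p) \<epsilon>)) #
     word_wt w (drop (fst p) \<delta>) (drop (snd p) \<epsilon>)"

lemma word_wt_append:
  "word_wt (u @ v) \<delta> \<epsilon> = word_wt u \<delta> \<epsilon> @
    word_wt v (drop (sum_list (map fst u)) \<delta>) (drop (sum_list (map snd u)) \<epsilon>)"
  by (induction u arbitrary: \<delta> \<epsilon>) (simp_all add: add.commute)

lemma length_word_wt [simp]: "length (word_wt w \<delta> \<epsilon>) = length w"
  by (induction w arbitrary: \<delta> \<epsilon>) simp_all

lemma sum_list_word_wt:
  "sum_list (word_wt w \<delta> \<epsilon>) =
    sum_list (take (sum_list (map fst w)) \<delta>) + sum_list (take (sum_list (map snd w)) \<epsilon>)"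
  by (induction w arbitrary: \<delta> \<epsilon>) (simp_all add: take_add)

lemma sum_swap_pair:
  "(\<Sum>b\<in>B. \<Sum>i\<in>I. \<Sum>j\<in>J. F b i j) = (\<Sum>i\<in>I. \<Sum>j\<in>J. \<Sum>b\<in>B. F b i j)"
  by (subst sum.swap) (intro sum.cong refl sum.swap)

lemma sum_swap_pairs:
  "(\<Sum>a\<in>A. \<Sum>b\<in>B. \<Sum>i\<in>I. \<Sum>j\<in>J. F a b i j) = (\<Sum>i\<in>I. \<Sum>j\<in>J. \<Sum>a\<in>A. \<Sum>b\<in>B. F a b i j)"
proof -
  have "(\<Sum>a\<in>A. \<Sum>b\<in>B. \<Sum>i\<in>I. \<Sum>j\<in>J. F a b i j) = (\<Sum>a\<in>A. \<Sum>i\<in>I. \<Sum>j\<in>J. \<Sum>b\<in>B. F a b i j)"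
    by (intro sum.cong refl sum_swap_pair)
  also have "\<dots> = (\<Sum>i\<in>I. \<Sum>j\<in>J. \<Sum>a\<in>A. \<Sum>b\<in>B. F a b i j)"
    by (rule sum_swap_pair)
  finally show ?thesis .
qed

text \<open>
  The product rule on the level of coefficients, by induction on the variables. The first variable
  receives initial blocks of \<open>\<delta>\<close> and \<open>\<epsilon>\<close> on the left, and an initial subword on the right. Sorting
  both sides by the lengths \<open>i\<close> and \<open>j\<close> of the blocks that are used up separates the first
  variable, which is the identity for a single variable, from the rest, which is the induction
  hypothesis.
\<close>

lemma eta_coeff_product:
  "(\<Sum>as\<in>lists_below cs. eta_coeff q \<delta> as * eta_coeff q \<epsilon> (map2 (-) cs as)) =
    (\<Sum>w\<in>fiber_words (length \<delta>) (length \<epsilon>). word_weight q w * eta_coeff q (word_wt w \<delta> \<epsilon>) cs)"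
proof (induction cs arbitrary: \<delta> \<epsilon>)
  case Nil
  have *: "word_wt w \<delta> \<epsilon> = [] \<longleftrightarrow> w = []" for w by (cases w) auto
  have "(\<Sum>w\<in>fiber_words (length \<delta>) (length \<epsilon>). word_weight q w * eta_coeff q (word_wt w \<delta> \<epsilon>) []) =
    (\<Sum>w\<in>fiber_words (length \<delta>) (length \<epsilon>). if w = [] then 1 else 0)"
    by (rule sum.cong) (auto simp: *)
  then show ?case by (simp add: Nil_in_fiber_words_iff)
next
  case (Cons c cs)
  \<comment> \<open>the contribution of the remaining variables\<close>
  define L where "L i j = (\<Sum>as\<in>lists_below cs.
    eta_coeff q (drop i \<delta>) as * eta_coeff q (drop j \<epsilon>) (map2 (-) cs as))" for i j
  let ?\<sigma> = "\<lambda>i. sum_list (take i \<delta>)" and ?\<tau> = "\<lambda>j. sum_list (take j \<epsilon>)"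
  let ?h = "block_factor q"
  let ?M = "\<Sum>i\<le>length \<delta>. \<Sum>j\<le>length \<epsilon>. if ?\<sigma> i + ?\<tau> j = c then ?h i * ?h j * L i j else 0"
  have "(\<Sum>as\<in>lists_below (c # cs). eta_coeff q \<delta> as * eta_coeff q \<epsilon> (map2 (-) (c # cs) as)) =
    (\<Sum>a\<le>c. \<Sum>as\<in>lists_below cs. \<Sum>i\<le>length \<delta>. \<Sum>j\<le>length \<epsilon>.
      (if ?\<sigma> i = a then ?h i * eta_coeff q (drop i \<delta>) as else 0) *
      (if ?\<tau> j = c - a then ?h j * eta_coeff q (drop j \<epsilon>) (map2 (-) cs as) else 0))"
    by (simp add: sum_lists_below_Cons sum_product)
  also have "\<dots> = (\<Sum>i\<le>length \<delta>. \<Sum>j\<le>length \<epsilon>. \<Sum>a\<le>c. \<Sum>as\<in>lists_below cs.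
      (if ?\<sigma> i = a then ?h i * eta_coeff q (drop i \<delta>) as else 0) *
      (if ?\<tau> j = c - a then ?h j * eta_coeff q (drop j \<epsilon>) (map2 (-) cs as) else 0))"
    by (rule sum_swap_pairs)
  also have "\<dots> = ?M"
  proof (intro sum.cong refl)
    fix i j
    have "(\<Sum>a\<le>c. \<Sum>as\<in>lists_below cs.
      (if ?\<sigma> i = a then ?h i * eta_coeff q (drop i \<delta>) as else 0) *
      (if ?\<tau> j = c - a then ?h j * eta_coeff q (drop j \<epsilon>) (map2 (-) cs as) else 0)) =
      (\<Sum>a\<le>c. if a = ?\<sigma> i then if ?\<sigma> i + ?\<tau> j = c then ?h i * ?h j * L i j else 0 else 0)"
    proof (rule sum.cong)
      fix a assume "a \<in> {..c}"
      then have iff: "?\<tau> j = c - a \<longleftrightarrow> a + ?\<tau> j = c" by auto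
      show "(\<Sum>as\<in>lists_below cs.
        (if ?\<sigma> i = a then ?h i * eta_coeff q (drop i \<delta>) as else 0) *
        (if ?\<tau> j = c - a then ?h j * eta_coeff q (drop j \<epsilon>) (map2 (-) cs as) else 0)) =
        (if a = ?\<sigma> i then if ?\<sigma> i + ?\<tau> j = c then ?h i * ?h j * L i j else 0 else 0)"
        unfolding iff by (simp add: L_def sum_distrib_left mult_ac)
    qed simp
    then show "(\<Sum>a\<le>c. \<Sum>as\<in>lists_below cs.
      (if ?\<sigma> i = a then ?h i * eta_coeff q (drop i \<delta>) as else 0) *
      (if ?\<tau> j = c - a then ?h j * eta_coeff q (drop j \<epsilon>) (map2 (-) cs as) else 0)) =
      (if ?\<sigma> i + ?\<tau> j = c then ?h i * ?h j * L i j else 0)" by auto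
  qed
  finally have left: "(\<Sum>as\<in>lists_below (c # cs).
    eta_coeff q \<delta> as * eta_coeff q \<epsilon> (map2 (-) (c # cs) as)) = ?M" .

  \<comment> \<open>the contribution of a word that is cut into \<open>u\<close>, assigned to the first variable, and \<open>v\<close>\<close>
  define G where "G u v = (let i = sum_list (map fst u); j = sum_list (map snd u) in
    if ?\<sigma> i + ?\<tau> j = c then word_weight q u * ?h (length u) *
      (word_weight q v * eta_coeff q (word_wt v (drop i \<delta>) (drop j \<epsilon>)) cs) else 0)" for u v
  have G: "word_weight q w * eta_coeff q (word_wt w \<delta> \<epsilon>) (c # cs) =
    (\<Sum>t\<le>length w. G (take t w) (drop t w))" for w
  proof -
    have "word_weight q w * (if sum_list (take t (word_wt w \<delta> \<epsilon>)) = c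
        then ?h t * eta_coeff q (drop t (word_wt w \<delta> \<epsilon>)) cs else 0) =
      G (take t w) (drop t w)" if "t \<le> length w" for t
    proof -
      obtain u v where w: "w = u @ v" "t = length u" "take t w = u" "drop t w = v"
        using \<open>t \<le> length w\<close> by (metis append_take_drop_id length_take min.absorb2)
      show ?thesis
        unfolding w(3,4) unfolding w(1,2)
        by (simp add: word_wt_append G_def Let_def sum_list_word_wt mult_ac)
    qed
    then show ?thesis by (simp add: sum_distrib_left)
  qed
  have "(\<Sum>w\<in>fiber_words (length \<delta>) (length \<epsilon>).
      word_weight q w * eta_coeff q (word_wt w \<delta> \<epsilon>) (c # cs)) =
    (\<Sum>i\<le>length \<delta>. \<Sum>j\<le>length \<epsilon>.
      \<Sum>u\<in>fiber_words i j. \<Sum>v\<in>fiber_words (length \<delta> - i) (length \<epsilon> - j). G u v)"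
    unfolding G by (rule sum_fiber_words_split)
  also have "\<dots> = ?M"
  proof (intro sum.cong refl)
    fix i j
    have "(\<Sum>u\<in>fiber_words i j. \<Sum>v\<in>fiber_words (length \<delta> - i) (length \<epsilon> - j). G u v) =
      (\<Sum>u\<in>fiber_words i j. \<Sum>v\<in>fiber_words (length \<delta> - i) (length \<epsilon> - j).
        if ?\<sigma> i + ?\<tau> j = c then word_weight q u * ?h (length u) *
        (word_weight q v * eta_coeff q (word_wt v (drop i \<delta>) (drop j \<epsilon>)) cs) else 0)"
      by (intro sum.cong refl) (auto simp: G_def fiber_words_def)
    also have "\<dots> = (if ?\<sigma> i + ?\<tau> j = c then
        (\<Sum>u\<in>fiber_words i j. word_weight q u * ?h (length u)) *
        (\<Sum>v\<in>fiber_words (length \<delta> - i) (length \<epsilon> - j).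
          word_weight q v * eta_coeff q (word_wt v (drop i \<delta>) (drop j \<epsilon>)) cs) else 0)"
      by (simp add: sum_product)
    also have "\<dots> = (if ?\<sigma> i + ?\<tau> j = c then ?h i * ?h j * L i j else 0)"
      unfolding sum_word_weight_block_factor L_def Cons.IH by simp
    finally show "(\<Sum>u\<in>fiber_words i j. \<Sum>v\<in>fiber_words (length \<delta> - i) (length \<epsilon> - j). G u v) =
      (if ?\<sigma> i + ?\<tau> j = c then ?h i * ?h j * L i j else 0)" .
  qed
  finally show ?case unfolding left ..
qed

section \<open>Stufufufflers as words\<close>

lemma down_closed_eq_lessThan:
  fixes A :: "nat set"
  assumes "finite A" and "\<And>x y. x \<in> A \<Longrightarrow> y \<le> x \<Longrightarrow> y \<in> A"
  shows "A = {..<card A}"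
proof (cases "A = {}")
  case False
  have "A = {..Max A}"
    using assms(2)[OF Max_in[OF assms(1) False]] Max_ge[OF assms(1)] by auto
  then show ?thesis by (metis card_atMost lessThan_Suc_atMost)
qed simp

text \<open>
  A weakly increasing map on a chain is determined by the sizes of its fibres: its sublevel sets
  are initial segments, whose lengths are the partial sums of the fibre sizes.
\<close>

lemma monotone_fibers:
  fixes g :: "nat \<Rightarrow> nat"
  assumes range: "\<And>u. u < l \<Longrightarrow> 1 \<le> g u"
    and mono: "\<And>u v. u < v \<Longrightarrow> v < l \<Longrightarrow> g u \<le> g v"
  shows "{u \<in> {..<l}. g u \<le> s} = {..<\<Sum>t=1..s. card {u \<in> {..<l}. g u = t}}"
proof -
  have "card {u \<in> {..<l}. g u \<le> s} = (\<Sum>t=1..s. card {u \<in> {..<l}. g u = t})"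
  proof (induction s)
    case 0
    have "{u \<in> {..<l}. g u \<le> 0} = {}" using range by fastforce
    then show ?case by (metis card.empty atLeastatMost_empty less_one sum.empty)
  next
    case (Suc s)
    have "{u \<in> {..<l}. g u \<le> Suc s} = {u \<in> {..<l}. g u \<le> s} \<union> {u \<in> {..<l}. g u = Suc s}"
      by auto
    moreover have "{u \<in> {..<l}. g u \<le> s} \<inter> {u \<in> {..<l}. g u = Suc s} = {}" by auto
    ultimately have "card {u \<in> {..<l}. g u \<le> Suc s} =
        card {u \<in> {..<l}. g u \<le> s} + card {u \<in> {..<l}. g u = Suc s}"
      using card_Un_disjoint[of "{u \<in> {..<l}. g u \<le> s}" "{u \<in> {..<l}. g u = Suc s}"]
      by fastforce
    then show ?case using Suc by simp
  qed
  moreover have "{u \<in> {..<l}. g u \<le> s} = {..<card {u \<in> {..<l}. g u \<le> s}}"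
  proof (rule down_closed_eq_lessThan)
    fix x y assume "x \<in> {u \<in> {..<l}. g u \<le> s}" "y \<le> x"
    then show "y \<in> {u \<in> {..<l}. g u \<le> s}"
      using mono[of y x] by (cases "y = x") auto
  qed simp
  ultimately show ?thesis by simp
qed

text \<open>
  Conversely, all sequences of fibre sizes occur, as successive intervals can be taken for the
  fibres.
\<close>

lemma monotone_map_with_fibers_exists:
  fixes c :: "nat \<Rightarrow> nat"
  shows "\<exists>g. (\<forall>u<(\<Sum>s=1..k. c s). g u \<in> {1..k}) \<and>
    (\<forall>u v. u < v \<longrightarrow> v < (\<Sum>s=1..k. c s) \<longrightarrow> g u \<le> g v) \<and>
    (\<forall>s\<in>{1..k}. card {u \<in> {..<\<Sum>s=1..k. c s}. g u = s} = c s)"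
proof (induction k)
  case (Suc k)
  define l where "l = (\<Sum>s=1..k. c s)"
  obtain g where g: "\<forall>u<l. g u \<in> {1..k}" "\<forall>u v. u < v \<longrightarrow> v < l \<longrightarrow> g u \<le> g v"
    "\<forall>s\<in>{1..k}. card {u \<in> {..<l}. g u = s} = c s" using Suc unfolding l_def by blast
  define h where "h u = (if u < l then g u else Suc k)" for u
  have total: "(\<Sum>s=1..Suc k. c s) = l + c (Suc k)" by (simp add: l_def)
  have g1: "1 \<le> g u \<and> g u \<le> k" if "u < l" for u using g(1) that by auto
  have "h u = Suc k \<longleftrightarrow> l \<le> u" for u
    using g1[of u] by (auto simp: h_def)
  then have "{u \<in> {..<l + c (Suc k)}. h u = Suc k} = {l..<l + c (Suc k)}"
    by (intro set_eqI) (simp add: conj_commute)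
  moreover have "{u \<in> {..<l + c (Suc k)}. h u = s} = {u \<in> {..<l}. g u = s}" if "s \<in> {1..k}" for s
    using that by (auto simp: h_def)
  ultimately have card: "card {u \<in> {..<l + c (Suc k)}. h u = s} = c s" if "s \<in> {1..Suc k}" for s
    using g(3) that by (cases "s = Suc k") auto
  show ?case unfolding total
  proof (intro exI[of _ h] conjI allI impI ballI card)
    show "h u \<in> {1..Suc k}" for u using g1[of u] by (auto simp: h_def)
    show "h u \<le> h v" if "u < v" for u v
      using g(2)[rule_format, of u v] g1[of u] that by (auto simp: h_def)
  qed
qed simp

definition fiber_word :: "nat list \<Rightarrow> nat list \<Rightarrow> nat \<Rightarrow> (nat + nat \<Rightarrow> nat) \<Rightarrow> (nat \<times> nat) list" where
  "fiber_word \<delta> \<epsilon> k f = map (\<lambda>s. (card (fibP \<delta> f s), card (fibQ \<epsilon> f s))) [1..<Suc k]"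

lemma fiber_word_simps:
  "fiber_word \<delta> \<epsilon> 0 f = []"
  "fiber_word \<delta> \<epsilon> (Suc k) f =
    fiber_word \<delta> \<epsilon> k f @ [(card (fibP \<delta> f (Suc k)), card (fibQ \<epsilon> f (Suc k)))]"
  by (simp_all add: fiber_word_def)

lemma sum_list_fiber_word:
  "sum_list (map fst (fiber_word \<delta> \<epsilon> k f)) = (\<Sum>s=1..k. card (fibP \<delta> f s))"
  "sum_list (map snd (fiber_word \<delta> \<epsilon> k f)) = (\<Sum>s=1..k. card (fibQ \<epsilon> f s))"
  by (induction k) (simp_all add: fiber_word_simps)

lemma two_chains_iff [simp]:
  "Inl u \<in> two_chains \<delta> \<epsilon> \<longleftrightarrow> u < length \<delta>"
  "Inr v \<in> two_chains \<delta> \<epsilon> \<longleftrightarrow> v < length \<epsilon>"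
  by (auto simp: two_chains_def)

lemma stufufufflers_chains:
  assumes "(k, f) \<in> stufufufflers \<delta> \<epsilon>"
  shows "u < length \<delta> \<Longrightarrow> f (Inl u) \<in> {1..k}"
    and "v < length \<epsilon> \<Longrightarrow> f (Inr v) \<in> {1..k}"
    and "u < u' \<Longrightarrow> u' < length \<delta> \<Longrightarrow> f (Inl u) \<le> f (Inl u')"
    and "v < v' \<Longrightarrow> v' < length \<epsilon> \<Longrightarrow> f (Inr v) \<le> f (Inr v')"
proof -
  have f: "f ` two_chains \<delta> \<epsilon> = {1..k}"
    "\<forall>x\<in>two_chains \<delta> \<epsilon>. \<forall>y\<in>two_chains \<delta> \<epsilon>. chains_less x y \<longrightarrow> f x \<le> f y"
    using assms by (auto simp: stufufufflers_def)
  show "u < length \<delta> \<Longrightarrow> f (Inl u) \<in> {1..k}" "v < length \<epsilon> \<Longrightarrow> f (Inr v) \<in> {1..k}"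
    using f(1) two_chains_iff by blast+
  show "u < u' \<Longrightarrow> u' < length \<delta> \<Longrightarrow> f (Inl u) \<le> f (Inl u')"
    using f(2)[rule_format, of "Inl u" "Inl u'"] by simp
  show "v < v' \<Longrightarrow> v' < length \<epsilon> \<Longrightarrow> f (Inr v) \<le> f (Inr v')"
    using f(2)[rule_format, of "Inr v" "Inr v'"] by simp
qed

lemma stufufuffler_le_iff:
  assumes "(k, f) \<in> stufufufflers \<delta> \<epsilon>"
  shows "{u \<in> {..<length \<delta>}. f (Inl u) \<le> s} = {..<\<Sum>t=1..s. card (fibP \<delta> f t)}"
    and "{v \<in> {..<length \<epsilon>}. f (Inr v) \<le> s} = {..<\<Sum>t=1..s. card (fibQ \<epsilon> f t)}"
  unfolding fibP_def fibQ_def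
  by (rule monotone_fibers; use stufufufflers_chains[OF assms] in auto)+

lemma stufufuffler_fib_eq:
  assumes "(k, f) \<in> stufufufflers \<delta> \<epsilon>"
  shows "fibP \<delta> f (Suc s) = {\<Sum>t=1..s. card (fibP \<delta> f t)..<\<Sum>t=1..Suc s. card (fibP \<delta> f t)}"
    and "fibQ \<epsilon> f (Suc s) = {\<Sum>t=1..s. card (fibQ \<epsilon> f t)..<\<Sum>t=1..Suc s. card (fibQ \<epsilon> f t)}"
proof -
  have "fibP \<delta> f (Suc s) = {u \<in> {..<length \<delta>}. f (Inl u) \<le> Suc s} - {u \<in> {..<length \<delta>}. f (Inl u) \<le> s}"
    by (auto simp: fibP_def)
  then show "fibP \<delta> f (Suc s) = {\<Sum>t=1..s. card (fibP \<delta> f t)..<\<Sum>t=1..Suc s. card (fibP \<delta> f t)}"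
    unfolding stufufuffler_le_iff[OF assms] by auto
  have "fibQ \<epsilon> f (Suc s) = {v \<in> {..<length \<epsilon>}. f (Inr v) \<le> Suc s} - {v \<in> {..<length \<epsilon>}. f (Inr v) \<le> s}"
    by (auto simp: fibQ_def)
  then show "fibQ \<epsilon> f (Suc s) = {\<Sum>t=1..s. card (fibQ \<epsilon> f t)..<\<Sum>t=1..Suc s. card (fibQ \<epsilon> f t)}"
    unfolding stufufuffler_le_iff[OF assms] by auto
qed

lemma stufufuffler_sum_card:
  assumes "(k, f) \<in> stufufufflers \<delta> \<epsilon>"
  shows "(\<Sum>s=1..k. card (fibP \<delta> f s)) = length \<delta>" "(\<Sum>s=1..k. card (fibQ \<epsilon> f s)) = length \<epsilon>"
proof -
  have "{u \<in> {..<length \<delta>}. f (Inl u) \<le> k} = {..<length \<delta>}"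
    "{v \<in> {..<length \<epsilon>}. f (Inr v) \<le> k} = {..<length \<epsilon>}"
    using stufufufflers_chains(1,2)[OF assms] by auto
  then show "(\<Sum>s=1..k. card (fibP \<delta> f s)) = length \<delta>" "(\<Sum>s=1..k. card (fibQ \<epsilon> f s)) = length \<epsilon>"
    unfolding stufufuffler_le_iff[OF assms] by (metis card_lessThan)+
qed

lemma sum_list_take_drop:
  assumes "a + n \<le> length (xs :: nat list)"
  shows "sum_list (take n (drop a xs)) = (\<Sum>i\<in>{a..<a + n}. xs ! i)"
proof -
  have "sum_list (take n (drop a xs)) = (\<Sum>i\<in>{0..<n}. xs ! (i + a))"
    using assms by (simp add: sum_list_sum_nth add.commute)
  also have "\<dots> = (\<Sum>i\<in>{a..<a + n}. xs ! i)"
    using sum.shift_bounds_nat_ivl[of "(!) xs" 0 a n] by (simp add: add.commute)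
  finally show ?thesis .
qed

text \<open>
  The fibres are successive intervals of positions, so the sums over them are the block sums that
  \<^const>\<open>word_wt\<close> takes.
\<close>

lemma word_wt_fiber_word:
  assumes st: "(k, f) \<in> stufufufflers \<delta> \<epsilon>"
  shows "word_wt (fiber_word \<delta> \<epsilon> k f) \<delta> \<epsilon> = wt \<delta> \<epsilon> k f"
proof -
  \<comment> \<open>Truncating at \<open>j\<close> need not give a stufufuffler, so the induction keeps \<open>f\<close> and \<open>k\<close> fixed.\<close>
  have "word_wt (fiber_word \<delta> \<epsilon> j f) \<delta> \<epsilon> = wt \<delta> \<epsilon> j f" if "j \<le> k" for j
    using that
  proof (induction j)
    case 0
    show ?case by (simp add: fiber_word_simps wt_def)
  next
    case (Suc j)
    \<comment> \<open>the blocks lie within the lists, so \<open>take\<close> and \<open>drop\<close> do not truncate\<close>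
    have "(\<Sum>t=1..Suc j. card (fibP \<delta> f t)) \<le> (\<Sum>t=1..k. card (fibP \<delta> f t))"
      "(\<Sum>t=1..Suc j. card (fibQ \<epsilon> f t)) \<le> (\<Sum>t=1..k. card (fibQ \<epsilon> f t))"
      using Suc.prems by (intro sum_mono2; auto)+
    then have le: "(\<Sum>t=1..j. card (fibP \<delta> f t)) + card (fibP \<delta> f (Suc j)) \<le> length \<delta>"
      "(\<Sum>t=1..j. card (fibQ \<epsilon> f t)) + card (fibQ \<epsilon> f (Suc j)) \<le> length \<epsilon>"
      unfolding stufufuffler_sum_card[OF st] by simp_all
    have Suc_sum: "(\<Sum>t=1..Suc j. F t) = (\<Sum>t=1..j. F t) + F (Suc j)" for F :: "nat \<Rightarrow> nat"
      by simp
    have "sum_list (take (card (fibP \<delta> f (Suc j))) (drop (\<Sum>t=1..j. card (fibP \<delta> f t)) \<delta>)) =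
        (\<Sum>u\<in>fibP \<delta> f (Suc j). \<delta> ! u)"
      "sum_list (take (card (fibQ \<epsilon> f (Suc j))) (drop (\<Sum>t=1..j. card (fibQ \<epsilon> f t)) \<epsilon>)) =
        (\<Sum>v\<in>fibQ \<epsilon> f (Suc j). \<epsilon> ! v)"
      using sum_list_take_drop[OF le(1)] sum_list_take_drop[OF le(2)]
        stufufuffler_fib_eq[OF st, of j] unfolding Suc_sum by metis+
    then show ?case using Suc
      by (simp add: fiber_word_simps word_wt_append sum_list_fiber_word wt_def wt_at_def)
  qed
  then show ?thesis by simp
qed

lemma fiber_word_in_fiber_words:
  assumes st: "(k, f) \<in> stufufufflers \<delta> \<epsilon>"
  shows "fiber_word \<delta> \<epsilon> k f \<in> fiber_words (length \<delta>) (length \<epsilon>)"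
proof -
  have "(card (fibP \<delta> f s), card (fibQ \<epsilon> f s)) \<in> fiber_pairs" if "s \<in> {1..k}" for s
  proof -
    have "\<bar>int (card (fibP \<delta> f s)) - int (card (fibQ \<epsilon> f s))\<bar> \<le> 1"
      using st that by (auto simp: stufufufflers_def)
    moreover have "card (fibP \<delta> f s) \<noteq> 0 \<or> card (fibQ \<epsilon> f s) \<noteq> 0"
      using stufufuffler_fib_nonempty[OF st that] by simp
    ultimately show ?thesis
      unfolding fiber_pairs_def mem_Collect_eq case_prod_conv prod.inject by linarith
  qed
  then show ?thesis
    using sum_list_fiber_word stufufuffler_sum_card[OF st]
    by (auto simp: fiber_words_def fiber_word_def)
qed

lemma word_weight_fiber_word:
  assumes st: "(k, f) \<in> stufufufflers \<delta> \<epsilon>"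
  shows "word_weight q (fiber_word \<delta> \<epsilon> k f) = (- q) ^ loss \<delta> \<epsilon> k f * (q - 1) ^ poise \<delta> \<epsilon> k f"
proof -
  let ?c = "\<lambda>s. card (fibP \<delta> f s)" and ?d = "\<lambda>s. card (fibQ \<epsilon> f s)"
  have pos: "1 \<le> max (?c s) (?d s)" if "s \<in> {1..k}" for s
    using stufufuffler_fib_nonempty[OF st that]
    by (auto simp: le_max_iff_disj Suc_le_eq card_gt_0_iff)
  have "(\<Sum>s=1..k. max (?c s) (?d s) - 1) = loss \<delta> \<epsilon> k f"
    unfolding loss_def by (subst sum_subtractf_nat) (use pos in auto)
  moreover have "(\<Prod>s=1..k. if ?c s = ?d s then q - 1 else 1) = (q - 1) ^ poise \<delta> \<epsilon> k f"
    by (simp add: poise_def prod.If_cases Int_def)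
  moreover have "word_weight q (fiber_word \<delta> \<epsilon> k f) =
    (\<Prod>s=1..k. (- q) ^ (max (?c s) (?d s) - 1) * (if ?c s = ?d s then q - 1 else 1))"
    by (induction k) (simp_all add: fiber_word_simps pair_weight_def)
  ultimately show ?thesis by (simp only: prod.distrib flip: power_sum)
qed

lemma stufufuffler_determined_by_fibers:
  assumes "(k, f) \<in> stufufufflers \<delta> \<epsilon>" "(k, g) \<in> stufufufflers \<delta> \<epsilon>"
    and "\<And>s. s \<in> {1..k} \<Longrightarrow> card (fibP \<delta> f s) = card (fibP \<delta> g s) \<and> card (fibQ \<epsilon> f s) = card (fibQ \<epsilon> g s)"
  shows "f = g"
proof -
  have "f \<in> extensional (two_chains \<delta> \<epsilon>)" "g \<in> extensional (two_chains \<delta> \<epsilon>)"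
    using assms(1,2) by (auto simp: stufufufflers_def PiE_def)
  then show ?thesis
  proof (rule extensionalityI)
    have C: "(\<Sum>t=1..s. card (fibP \<delta> f t)) = (\<Sum>t=1..s. card (fibP \<delta> g t))"
      "(\<Sum>t=1..s. card (fibQ \<epsilon> f t)) = (\<Sum>t=1..s. card (fibQ \<epsilon> g t))" if "s \<le> k" for s
      using assms(3) that by (auto intro!: sum.cong)
    have sets: "{u \<in> {..<length \<delta>}. f (Inl u) \<le> s} = {u \<in> {..<length \<delta>}. g (Inl u) \<le> s}"
      "{v \<in> {..<length \<epsilon>}. f (Inr v) \<le> s} = {v \<in> {..<length \<epsilon>}. g (Inr v) \<le> s}" if "s \<le> k" for s
      using stufufuffler_le_iff[OF assms(1), of s] stufufuffler_le_iff[OF assms(2), of s] C[OF that]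
      by simp_all
    have P: "f (Inl u) \<le> s \<longleftrightarrow> g (Inl u) \<le> s" if "u < length \<delta>" "s \<le> k" for u s
      using sets(1)[OF that(2)] that(1) by blast
    have Q: "f (Inr v) \<le> s \<longleftrightarrow> g (Inr v) \<le> s" if "v < length \<epsilon>" "s \<le> k" for v s
      using sets(2)[OF that(2)] that(1) by blast
    fix x assume "x \<in> two_chains \<delta> \<epsilon>"
    then consider u where "x = Inl u" "u < length \<delta>" | v where "x = Inr v" "v < length \<epsilon>"
      by (auto simp: two_chains_def)
    then show "f x = g x"
    proof cases
      case 1
      then show ?thesis
        using P[of u "f x"] P[of u "g x"] stufufufflers_chains(1)[OF assms(1), of u]
          stufufufflers_chains(1)[OF assms(2), of u] by auto
    next
      case 2
      then show ?thesis
        using Q[of v "f x"] Q[of v "g x"] stufufufflers_chains(2)[OF assms(1), of v]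
          stufufufflers_chains(2)[OF assms(2), of v] by auto
    qed
  qed
qed

text \<open>
  Every letter has a positive entry, so the map built from a word hits every value.
\<close>

lemma fiber_words_surj:
  assumes "w \<in> fiber_words (length \<delta>) (length \<epsilon>)"
  shows "\<exists>f. (length w, f) \<in> stufufufflers \<delta> \<epsilon> \<and> fiber_word \<delta> \<epsilon> (length w) f = w"
proof -
  define k where "k = length w"
  \<comment> \<open>the values of a stufufuffler are counted from 1, the letters of a word from 0\<close>
  define c where "c s = fst (w ! (s - 1))" for s
  define d where "d s = snd (w ! (s - 1))" for s
  have w: "w = map (\<lambda>s. (c s, d s)) [1..<Suc k]"
    by (rule nth_equalityI) (simp_all add: c_def d_def k_def del: upt_Suc)
  have "sum_list (map fst w) = (\<Sum>s=1..k. c s)" "sum_list (map snd w) = (\<Sum>s=1..k. d s)"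
    unfolding w by (induction k) simp_all
  then have sums: "(\<Sum>s=1..k. c s) = length \<delta>" "(\<Sum>s=1..k. d s) = length \<epsilon>"
    using assms by (simp_all add: fiber_words_def)
  have pairs: "(c s, d s) \<in> fiber_pairs" if "s \<in> {1..k}" for s
  proof -
    have "(c s, d s) \<in> set w" unfolding w using that by (auto simp del: upt_Suc)
    then show ?thesis using assms by (auto simp: fiber_words_def)
  qed
  obtain g where g: "\<forall>u<length \<delta>. g u \<in> {1..k}" "\<forall>u v. u < v \<longrightarrow> v < length \<delta> \<longrightarrow> g u \<le> g v"
    "\<forall>s\<in>{1..k}. card {u \<in> {..<length \<delta>}. g u = s} = c s"
    using monotone_map_with_fibers_exists[where c = c and k = k] unfolding sums by blast
  obtain h where h: "\<forall>u<length \<epsilon>. h u \<in> {1..k}" "\<forall>u v. u < v \<longrightarrow> v < length \<epsilon> \<longrightarrow> h u \<le> h v"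
    "\<forall>s\<in>{1..k}. card {u \<in> {..<length \<epsilon>}. h u = s} = d s"
    using monotone_map_with_fibers_exists[where c = d and k = k] unfolding sums by blast
  define f where "f = restrict (case_sum g h) (two_chains \<delta> \<epsilon>)"
  have f: "f (Inl u) = g u" if "u < length \<delta>" for u using that by (simp add: f_def)
  have f': "f (Inr u) = h u" if "u < length \<epsilon>" for u using that by (simp add: f_def)
  have fib: "fibP \<delta> f s = {u \<in> {..<length \<delta>}. g u = s}" "fibQ \<epsilon> f s = {u \<in> {..<length \<epsilon>}. h u = s}" for s
    using f f' by (auto simp: fibP_def fibQ_def)
  have cards: "card (fibP \<delta> f s) = c s" "card (fibQ \<epsilon> f s) = d s" if "s \<in> {1..k}" for s
    using g(3) h(3) that by (simp_all add: fib)
  have into: "f x \<in> {1..k}" if "x \<in> two_chains \<delta> \<epsilon>" for x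
    using that g(1) h(1) f f' by (auto simp: two_chains_def)
  have "s \<in> f ` two_chains \<delta> \<epsilon>" if "s \<in> {1..k}" for s
  proof -
    have "fibP \<delta> f s \<noteq> {} \<or> fibQ \<epsilon> f s \<noteq> {}"
      using pairs[OF that] cards[OF that] by (auto simp: fiber_pairs_def)
    then show ?thesis by (auto simp: fibP_def fibQ_def two_chains_def image_iff)
  qed
  then have "f ` two_chains \<delta> \<epsilon> = {1..k}" using into by blast
  moreover have "f \<in> two_chains \<delta> \<epsilon> \<rightarrow>\<^sub>E {1..k}"
    using into by (auto simp: f_def PiE_def)
  moreover have "f x \<le> f y" if "x \<in> two_chains \<delta> \<epsilon>" "y \<in> two_chains \<delta> \<epsilon>" "chains_less x y" for x y
    using that g(2) h(2) f f' by (cases x; cases y) (auto simp: two_chains_def)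
  moreover have "\<bar>int (card (fibP \<delta> f s)) - int (card (fibQ \<epsilon> f s))\<bar> \<le> 1" if "s \<in> {1..k}" for s
    using pairs[OF that] cards[OF that] by (auto simp: fiber_pairs_def)
  ultimately have "(k, f) \<in> stufufufflers \<delta> \<epsilon>"
    unfolding stufufufflers_def by blast
  moreover have "fiber_word \<delta> \<epsilon> k f = w"
    unfolding fiber_word_def w using cards by (auto simp del: upt_Suc)
  ultimately show ?thesis by (auto simp: k_def)
qed

lemma bij_betw_fiber_word:
  "bij_betw (\<lambda>(k, f). fiber_word \<delta> \<epsilon> k f) (stufufufflers \<delta> \<epsilon>) (fiber_words (length \<delta>) (length \<epsilon>))"
proof (rule bij_betw_imageI)
  show "inj_on (\<lambda>(k, f). fiber_word \<delta> \<epsilon> k f) (stufufufflers \<delta> \<epsilon>)"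
  proof (rule inj_onI, clarify)
    fix k f k' g
    assume st: "(k, f) \<in> stufufufflers \<delta> \<epsilon>" "(k', g) \<in> stufufufflers \<delta> \<epsilon>"
      and eq: "fiber_word \<delta> \<epsilon> k f = fiber_word \<delta> \<epsilon> k' g"
    have "k = k'" using arg_cong[OF eq, of length] by (simp add: fiber_word_def del: upt_Suc)
    moreover have "f = g"
      using stufufuffler_determined_by_fibers[of k f \<delta> \<epsilon> g] st eq \<open>k = k'\<close>
      by (auto simp: fiber_word_def simp del: upt_Suc)
    ultimately show "k = k' \<and> f = g" ..
  qed
  show "(\<lambda>(k, f). fiber_word \<delta> \<epsilon> k f) ` stufufufflers \<delta> \<epsilon> = fiber_words (length \<delta>) (length \<epsilon>)"
  proof (intro subset_antisym subsetI)
    fix w assume "w \<in> fiber_words (length \<delta>) (length \<epsilon>)"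
    then obtain f where "(length w, f) \<in> stufufufflers \<delta> \<epsilon>" "fiber_word \<delta> \<epsilon> (length w) f = w"
      using fiber_words_surj by blast
    then show "w \<in> (\<lambda>(k, f). fiber_word \<delta> \<epsilon> k f) ` stufufufflers \<delta> \<epsilon>"
      by (intro image_eqI[where x = "(length w, f)"]) simp_all
  qed (auto intro: fiber_word_in_fiber_words)
qed

section \<open>The product rule\<close>

theorem theorem5p9:
  fixes q :: "'k :: comm_ring_1" and \<delta> \<epsilon> :: "nat list"
  assumes "\<delta> \<in> Comp" and "\<epsilon> \<in> Comp"
  shows "eta q \<delta> * eta q \<epsilon> =
    (\<Sum>(k, f)\<in>stufufufflers \<delta> \<epsilon>.
      ((- q) ^ loss \<delta> \<epsilon> k f * (q - 1) ^ poise \<delta> \<epsilon> k f) *\<^sub>m eta q (wt \<delta> \<epsilon> k f))"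
proof (rule mfps_eqI)
  fix m :: monom
  define vs where "vs = sorted_list_of_set (Poly_Mapping.keys m)"
  define cs where "cs = map (Poly_Mapping.lookup m) vs"
  have vs: "sorted_wrt (<) vs" "distinct vs" "length vs = length cs"
    by (simp_all add: vs_def cs_def)
  have m: "monom_of vs cs = m"
    unfolding cs_def by (rule monom_of_map_lookup) (simp_all add: vs_def)
  have "coeff (eta q \<delta> * eta q \<epsilon>) m =
    (\<Sum>as\<in>lists_below cs. eta_coeff q \<delta> as * eta_coeff q \<epsilon> (map2 (-) cs as))"
  proof -
    have "length as = length cs" if "as \<in> lists_below cs" for as
      using that by (auto simp: lists_below_def dest: list_all2_lengthD)
    then show ?thesis
      unfolding m[symmetric] coeff_mult_monom_of[OF vs(3,2)]
      using vs assms by (intro sum.cong refl) (simp add: coeff_eta)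
  qed
  also have "\<dots> = (\<Sum>w\<in>fiber_words (length \<delta>) (length \<epsilon>).
      word_weight q w * eta_coeff q (word_wt w \<delta> \<epsilon>) cs)"
    by (rule eta_coeff_product)
  also have "\<dots> = (\<Sum>p\<in>stufufufflers \<delta> \<epsilon>.
      word_weight q (case p of (k, f) \<Rightarrow> fiber_word \<delta> \<epsilon> k f) *
      eta_coeff q (word_wt (case p of (k, f) \<Rightarrow> fiber_word \<delta> \<epsilon> k f) \<delta> \<epsilon>) cs)"
    by (rule sum.reindex_bij_betw[OF bij_betw_fiber_word, symmetric])
  also have "\<dots> = coeff (\<Sum>(k, f)\<in>stufufufflers \<delta> \<epsilon>.
      ((- q) ^ loss \<delta> \<epsilon> k f * (q - 1) ^ poise \<delta> \<epsilon> k f) *\<^sub>m eta q (wt \<delta> \<epsilon> k f)) m"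
    unfolding coeff_sum
  proof (intro sum.cong refl, clarify)
    fix k f assume st: "(k, f) \<in> stufufufflers \<delta> \<epsilon>"
    have "coeff (eta q (wt \<delta> \<epsilon> k f)) m = eta_coeff q (wt \<delta> \<epsilon> k f) cs"
      unfolding m[symmetric] by (rule coeff_eta[OF wt_in_Comp[OF assms st] vs(3,1)])
    then show "word_weight q (fiber_word \<delta> \<epsilon> k f) * eta_coeff q (word_wt (fiber_word \<delta> \<epsilon> k f) \<delta> \<epsilon>) cs =
      coeff (((- q) ^ loss \<delta> \<epsilon> k f * (q - 1) ^ poise \<delta> \<epsilon> k f) *\<^sub>m eta q (wt \<delta> \<epsilon> k f)) m"
      by (simp add: word_weight_fiber_word[OF st] word_wt_fiber_word[OF st])
  qed
  finally show "coeff (eta q \<delta> * eta q \<epsilon>) m = coeff (\<Sum>(k, f)\<in>stufufufflers \<delta> \<epsilon>.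
      ((- q) ^ loss \<delta> \<epsilon> k f * (q - 1) ^ poise \<delta> \<epsilon> k f) *\<^sub>m eta q (wt \<delta> \<epsilon> k f)) m" .
qed

end
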